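(* Let $\pi$ be a noncrossing partition with $n$ blocks. Then $\phi_{\mathcal{NCP}}(\pi)$ is a polynomial of degree $n$. The coefficient of $X^{n-1}$ in it is $$-\frac{1}{(|\pi|-1)!}\left(\sum_{(b,b')\text{ close pair of }\pi}\mathrm{le}(\pi/(b,b'))+\frac12\sum_{(b,b')\text{ nested pair of }\pi}\mathrm{le}(\pi/(b,b'))\right).$$
   Context: $\mathbb{K}$ is a field of characteristic zero. A noncrossing partition is a partition $\pi$ of a set $[n]=\{1,\ldots,n\}$, $n\ge1$, into nonempty blocks such that there are no distinct blocks $b\ne b'$ and $x,z\in b$, $y,t\in b'$ with $x<y<z<t$. $|\pi|$ is its number of blocks; $\mathcal{NCP}$ is the set of all noncrossing partitions. The nesting order on blocks is $b\le_\pi b'\iff b'\subseteq[\min b,\max b]$. $\mathrm{le}(\pi)$ is the number of linear extensions of the poset of blocks $(\pi,\le_\pi)$, i.e. bijections $f:\pi\to[|\pi|]$ with $b\le_\pi b'\Rightarrow f(b)\le f(b')$. The equivalence $\sim_\pi$ on blocks: $b\sim_\pi b'$ if there is a sequence $(b_1,\ldots,b_k)$ of blocks with $b_1=b,b_k=b'$ or $b_1=b',b_k=b$, and $\max(b_i)+1=\min(b_{i+1})$ for $1\le i\le k-1$. For two different blocks $b,b'$: $(b,b')$ is a close pair if $\max(b)<\min(b')$ and $b\sim_\pi b'$; $(b,b')$ is a nested pair if $b\le_\pi b'$ and every block $b''$ with $b\le_\pi b''\le_\pi b'$ is $b$ or $b'$. If $(b,b')$ is a close or a nested pair, $\pi/(b,b')$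 is the (noncrossing) partition whose blocks are $b\sqcup b'$ and the other blocks of $\pi$. For a nonempty set $Y$ of blocks of $\pi$, $\pi_{\mid Y}$ is the noncrossing partition obtained by deleting the blocks not in $Y$ and renumbering the remaining elements increasingly; $\pi_{\mid\emptyset}=1$. An ideal of $\pi$ is a set $J$ of blocks that is upward closed for $\le_\pi$; then the union of its blocks decomposes into maximal subsets of consecutive integers $I_1,\ldots,I_k$, each a union of blocks, and $\pi_{\mid_\cdot J}=\prod_i\pi_{\mid I_i}$ (restriction to the blocks contained in $I_i$; product $\cdot$ below). $\mathbb{K}[\mathcal{NCP}]$ is the free commutative algebra generated by $\mathcal{NCP}$, with product $\cdot$ and unit $1$. It carries two coproducts which are algebra morphisms, given on $\pi\in\mathcal{NCP}$ by $\Delta(\pi)=\sum_{J\text{ ideal of }\pi}\pi_{\mid\pi\setminus J}\otimes\pi_{\mid_\cdot J}$ and $\delta(\pi)=\sum_{\sim\in\mathcal{E}_c[\pi]}\pi/\!\sim\,\otimes\,\pi\mid_\cdot\sim$, where, for an equivalence $\sim$ on the set of blocks of $\pi$, $\pi/\!\sim$ is the partition whose blocks are the unions of the blocks in each class, $\mathcal{E}_c[\pi]$ is the set of $\sim$ for which $\pi/\!\sim$ is noncrossing, and $\pi\mid_\cdot\sim=\prod_{C\text{ class of }\sim}\pi_{\mid C}$. The counits are the algebra morphisms with $\varepsilon_\Delta(\pi)=0$, and $\epsilon_\delta(\pi)=1$ if $|\pi|=1$, $\epsilon_\delta(\pi)=0$ otherwise. $\mathbb{K}[X]$ has the multiplicative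 coproducts $\Delta(X)=X\otimes1+1\otimes X$, $\delta(X)=X\otimes X$ with counits $P\mapsto P(0)$, $P\mapsto P(1)$. $\phi_{\mathcal{NCP}}:\mathbb{K}[\mathcal{NCP}]\to\mathbb{K}[X]$ is the unique algebra morphism compatible with both coproducts $\Delta,\delta$ and both counits. By known results it exists, is unique, and for $x\in\ker\varepsilon_\Delta$, $\phi_{\mathcal{NCP}}(x)=\sum_{k\ge1}\epsilon_\delta^{\otimes k}\circ\tilde\Delta^{(k-1)}(x)\,H_k(X)$, with $\tilde\Delta(x)=\Delta(x)-x\otimes1-1\otimes x$, $\tilde\Delta^{(k-1)}$ its iterates ($\tilde\Delta^{(0)}=\mathrm{Id}$), and $H_k(X)=X(X-1)\cdots(X-k+1)/k!$. *)

theory Defs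
  imports Complex_Main "HOL-Library.Disjoint_Sets" "HOL-Library.FuncSet" "HOL-Library.Multiset"
    "HOL-Library.Product_Plus" "HOL-Library.Poly_Mapping" "HOL-Computational_Algebra.Polynomial"
begin

section \<open>Noncrossing partitions\<close>

definition noncrossing :: "nat set set \<Rightarrow> bool" where
  "noncrossing P \<longleftrightarrow>
     \<not> (\<exists>b\<in>P. \<exists>b'\<in>P. b \<noteq> b' \<and> (\<exists>x\<in>b. \<exists>y\<in>b'. \<exists>z\<in>b. \<exists>t\<in>b'. x < y \<and> y < z \<and> z < t))"

definition is_ncp :: "nat set set \<Rightarrow> bool" where
  "is_ncp P \<longleftrightarrow> (\<exists>n\<ge>1. partition_on {1..n} P) \<and> noncrossing P"

typedef ncp = "{P. is_ncp P}"
  morphisms blocks Abs_ncp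
proof -
  have "partition_on {1..1::nat} {{1}}" by (auto simp: partition_on_def)
  then have "is_ncp {{1}}" unfolding is_ncp_def noncrossing_def by auto
  then show ?thesis by auto
qed

definition nest_le :: "nat set \<Rightarrow> nat set \<Rightarrow> bool" where
  "nest_le b b' \<longleftrightarrow> b' \<subseteq> {Min b..Max b}"

definition num_lin_ext :: "nat set set \<Rightarrow> nat" where
  "num_lin_ext P = card {f \<in> P \<rightarrow>\<^sub>E {1..card P}.
     bij_betw f P {1..card P} \<and> (\<forall>b\<in>P. \<forall>b'\<in>P. nest_le b b' \<longrightarrow> f b \<le> f b')}"

definition chained :: "nat set set \<Rightarrow> nat set \<Rightarrow> nat set \<Rightarrow> bool" where
  "chained P b b' \<longleftrightarrow> (\<exists>bs. bs \<noteq> [] \<and> set bs \<subseteq> P \<and>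
     (hd bs = b \<and> last bs = b' \<or> hd bs = b' \<and> last bs = b) \<and>
     successively (\<lambda>c c'. Max c + 1 = Min c') bs)"

definition close_pairs :: "nat set set \<Rightarrow> (nat set \<times> nat set) set" where
  "close_pairs P = {(b, b'). b \<in> P \<and> b' \<in> P \<and> b \<noteq> b' \<and> Max b < Min b' \<and> chained P b b'}"

definition nested_pairs :: "nat set set \<Rightarrow> (nat set \<times> nat set) set" where
  "nested_pairs P = {(b, b'). b \<in> P \<and> b' \<in> P \<and> b \<noteq> b' \<and> nest_le b b' \<and>
     (\<forall>c\<in>P. nest_le b c \<and> nest_le c b' \<longrightarrow> c = b \<or> c = b')}"

definition merge_pair :: "nat set set \<Rightarrow> nat set \<times> nat set \<Rightarrow> nat set set" where
  "merge_pair P = (\<lambda>(b, b'). insert (b \<union> b') (P - {b, b'}))"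

text \<open>The map \<open>x \<mapsto> card {y \<in> S. y \<le> x}\<close> is the increasing bijection from a finite set \<open>S\<close>
  onto \<open>{1..card S}\<close>.\<close>

definition standardize :: "nat set set \<Rightarrow> nat set set" where
  "standardize Y = (\<lambda>b. (\<lambda>x. card {y \<in> \<Union>Y. y \<le> x}) ` b) ` Y"

definition ideals :: "nat set set \<Rightarrow> nat set set set" where
  "ideals P = {J. J \<subseteq> P \<and> (\<forall>b\<in>J. \<forall>b'\<in>P. nest_le b b' \<longrightarrow> b' \<in> J)}"

definition runs :: "nat set \<Rightarrow> nat set set" where
  "runs S = {I. I \<subseteq> S \<and> (\<exists>a b. a \<le> b \<and> I = {a..b}) \<and>
     (\<forall>a b. I \<subseteq> {a..b} \<and> {a..b} \<subseteq> S \<longrightarrow> I = {a..b})}"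

definition quotient_blocks :: "nat set set \<Rightarrow> (nat set \<times> nat set) set \<Rightarrow> nat set set" where
  "quotient_blocks P r = Union ` (P // r)"

definition admissible :: "nat set set \<Rightarrow> (nat set \<times> nat set) set set" where
  "admissible P = {r. equiv P r \<and> noncrossing (quotient_blocks P r)}"

section \<open>The free commutative algebra on noncrossing partitions\<close>

text \<open>The free commutative algebra on a set is the monoid algebra of the free commutative monoid,
  i.e. of the finite multisets over that set under union; its multiplication is the convolution
  product of \<^theory>\<open>HOL-Library.Poly_Mapping\<close>. The tensor square of a monoid algebra is the monoid
  algebra of the product monoid.\<close>

type_synonym 'k ncp_alg = "ncp multiset \<Rightarrow>\<^sub>0 'k"
type_synonym 'k ncp_tensor = "(ncp multiset \<times> ncp multiset) \<Rightarrow>\<^sub>0 'k"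

definition gen :: "ncp \<Rightarrow> 'k::field_char_0 ncp_alg" where
  "gen \<pi> = Poly_Mapping.single {#\<pi>#} 1"

definition tensor :: "'k::field_char_0 ncp_alg \<Rightarrow> 'k ncp_alg \<Rightarrow> 'k ncp_tensor" where
  "tensor x y = (\<Sum>m\<in>Poly_Mapping.keys x. \<Sum>m'\<in>Poly_Mapping.keys y.
     Poly_Mapping.single (m, m') (Poly_Mapping.lookup x m * Poly_Mapping.lookup y m'))"

text \<open>The algebra morphism extending a map \<open>f\<close> on generators, with values in a commutative
  ring \<open>'b\<close> that is a \<open>'k\<close>-algebra through the structure map \<open>s\<close>.\<close>

definition alg_extend ::
  "('k \<Rightarrow> 'b::comm_ring_1) \<Rightarrow> (ncp \<Rightarrow> 'b) \<Rightarrow> 'k::field_char_0 ncp_alg \<Rightarrow> 'b" where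
  "alg_extend s f x =
     (\<Sum>m\<in>Poly_Mapping.keys x. s (Poly_Mapping.lookup x m) * prod_mset (image_mset f m))"

definition restrict_ncp :: "nat set set \<Rightarrow> 'k::field_char_0 ncp_alg" where
  "restrict_ncp Y = (if Y = {} then 1 else gen (Abs_ncp (standardize Y)))"

definition restrict_dot_ideal :: "nat set set \<Rightarrow> nat set set \<Rightarrow> 'k::field_char_0 ncp_alg" where
  "restrict_dot_ideal P J = (\<Prod>I\<in>runs (\<Union>J). restrict_ncp {b \<in> P. b \<subseteq> I})"

definition restrict_dot_equiv ::
  "nat set set \<Rightarrow> (nat set \<times> nat set) set \<Rightarrow> 'k::field_char_0 ncp_alg" where
  "restrict_dot_equiv P r = (\<Prod>C\<in>P // r. restrict_ncp C)"

definition Delta_gen :: "ncp \<Rightarrow> 'k::field_char_0 ncp_tensor" where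
  "Delta_gen \<pi> = (\<Sum>J\<in>ideals (blocks \<pi>).
     tensor (restrict_ncp (blocks \<pi> - J)) (restrict_dot_ideal (blocks \<pi>) J))"

definition delta_gen :: "ncp \<Rightarrow> 'k::field_char_0 ncp_tensor" where
  "delta_gen \<pi> = (\<Sum>r\<in>admissible (blocks \<pi>).
     tensor (gen (Abs_ncp (quotient_blocks (blocks \<pi>) r))) (restrict_dot_equiv (blocks \<pi>) r))"

definition Delta_ncp :: "'k::field_char_0 ncp_alg \<Rightarrow> 'k ncp_tensor" where
  "Delta_ncp = alg_extend (Poly_Mapping.single 0) Delta_gen"

definition delta_ncp :: "'k::field_char_0 ncp_alg \<Rightarrow> 'k ncp_tensor" where
  "delta_ncp = alg_extend (Poly_Mapping.single 0) delta_gen"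

definition counit_Delta :: "'k::field_char_0 ncp_alg \<Rightarrow> 'k" where
  "counit_Delta = alg_extend (\<lambda>c. c) (\<lambda>_. 0)"

definition counit_delta :: "'k::field_char_0 ncp_alg \<Rightarrow> 'k" where
  "counit_delta = alg_extend (\<lambda>c. c) (\<lambda>\<pi>. if card (blocks \<pi>) = 1 then 1 else 0)"

section \<open>The polynomial algebra and the morphism\<close>

text \<open>The tensor square of \<open>'k poly\<close> is identified with \<open>'k poly poly\<close>: the inner indeterminate
  is \<open>X \<otimes> 1\<close>, the outer one is \<open>1 \<otimes> X\<close>.\<close>

definition poly_tensor :: "'k::field_char_0 poly \<Rightarrow> 'k poly \<Rightarrow> 'k poly poly" where
  "poly_tensor p q = smult p (map_poly (\<lambda>c. [:c:]) q)"

definition subst_tensor :: "'k::field_char_0 poly \<Rightarrow> 'k poly poly \<Rightarrow> 'k poly poly" where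
  "subst_tensor p t = poly (map_poly (\<lambda>c. [:[:c:]:]) p) t"

definition Delta_poly :: "'k::field_char_0 poly \<Rightarrow> 'k poly poly" where
  "Delta_poly p = subst_tensor p (poly_tensor [:0, 1:] 1 + poly_tensor 1 [:0, 1:])"

definition delta_poly :: "'k::field_char_0 poly \<Rightarrow> 'k poly poly" where
  "delta_poly p = subst_tensor p (poly_tensor [:0, 1:] [:0, 1:])"

text \<open>For linear \<open>\<phi>\<close>, this is \<open>\<phi> \<otimes> \<phi>\<close>.\<close>

definition tensor_map ::
  "('k::field_char_0 ncp_alg \<Rightarrow> 'k poly) \<Rightarrow> 'k ncp_tensor \<Rightarrow> 'k poly poly" where
  "tensor_map \<phi> t = (\<Sum>(m, m')\<in>Poly_Mapping.keys t. smult [:Poly_Mapping.lookup t (m, m'):]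
     (poly_tensor (\<phi> (Poly_Mapping.single m 1)) (\<phi> (Poly_Mapping.single m' 1))))"

definition algebra_morphism :: "('k::field_char_0 ncp_alg \<Rightarrow> 'k poly) \<Rightarrow> bool" where
  "algebra_morphism \<phi> \<longleftrightarrow>
     (\<forall>x y. \<phi> (x + y) = \<phi> x + \<phi> y) \<and> (\<forall>x y. \<phi> (x * y) = \<phi> x * \<phi> y) \<and> \<phi> 1 = 1 \<and>
     (\<forall>c x. \<phi> (Poly_Mapping.single 0 c * x) = smult c (\<phi> x))"

definition double_bialgebra_morphism :: "('k::field_char_0 ncp_alg \<Rightarrow> 'k poly) \<Rightarrow> bool" where
  "double_bialgebra_morphism \<phi> \<longleftrightarrow>
     algebra_morphism \<phi> \<and>
     (\<forall>x. Delta_poly (\<phi> x) = tensor_map \<phi> (Delta_ncp x)) \<and>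
     (\<forall>x. delta_poly (\<phi> x) = tensor_map \<phi> (delta_ncp x)) \<and>
     (\<forall>x. poly (\<phi> x) 0 = counit_Delta x) \<and>
     (\<forall>x. poly (\<phi> x) 1 = counit_delta x)"

section \<open>Well-definedness\<close>

text \<open>The arguments of \<^const>\<open>Abs_ncp\<close> above are noncrossing partitions.\<close>

lemma is_ncp_standardize:
  assumes P: "is_ncp P" and Y: "Y \<subseteq> P" "Y \<noteq> {}"
  shows "is_ncp (standardize Y)"
proof -
  obtain n where n: "partition_on {1..n} P" and nc: "noncrossing P"
    using P unfolding is_ncp_def by blast
  define S where "S = \<Union>Y"
  define g where "g = (\<lambda>x. card {y \<in> S. y \<le> x})"
  have dj: "disjoint P" and ne: "{} \<notin> P" and U: "\<Union>P = {1..n}"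
    using n unfolding partition_on_def by auto
  have "S \<subseteq> {1..n}" using U Y unfolding S_def by blast
  then have fin: "finite S" using finite_subset by blast
  have sm: "g x < g y" if "x < y" "x \<in> S" "y \<in> S" for x y
  proof -
    have "{z \<in> S. z \<le> x} \<subseteq> {z \<in> S. z \<le> y}" using that by auto
    moreover have "y \<in> {z \<in> S. z \<le> y}" "y \<notin> {z \<in> S. z \<le> x}" using that by auto
    ultimately have "{z \<in> S. z \<le> x} \<subset> {z \<in> S. z \<le> y}" by blast
    then show ?thesis unfolding g_def using fin by (intro psubset_card_mono) auto
  qed
  have mono: "x < y" if "g x < g y" "x \<in> S" "y \<in> S" for x y
    using sm[of y x] that by (cases x y rule: linorder_cases) auto
  have inj: "inj_on g S"
    by (rule linorder_inj_onI') (use sm in fastforce)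
  have "g ` S \<subseteq> {1..card S}"
  proof
    fix k assume "k \<in> g ` S"
    then obtain x where x: "x \<in> S" "k = g x" by blast
    have "{y \<in> S. y \<le> x} \<noteq> {}" using x by blast
    moreover have "finite {y \<in> S. y \<le> x}" using fin by simp
    ultimately have "g x \<noteq> 0" unfolding g_def by (simp only: card_0_eq) simp
    moreover have "g x \<le> card S" unfolding g_def by (rule card_mono) (use fin in auto)
    ultimately show "k \<in> {1..card S}" using x by simp
  qed
  then have img: "g ` S = {1..card S}"
    by (intro card_subset_eq) (auto simp: card_image[OF inj])
  have std: "standardize Y = (`) g ` Y"
    unfolding standardize_def g_def S_def by blast
  have sub: "b \<subseteq> S" if "b \<in> Y" for b using that unfolding S_def by blast
  have "S \<noteq> {}" using Y ne unfolding S_def by fastforce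
  then have c1: "card S \<ge> 1" using fin by (simp add: Suc_le_eq card_gt_0_iff)
  have "partition_on {1..card S} (standardize Y)"
  proof (rule partition_onI)
    show "\<Union>(standardize Y) = {1..card S}" 
      unfolding std using img unfolding S_def by (simp add: image_Union)
    show "{} \<notin> standardize Y" using Y ne unfolding std by auto
    show "disjnt p p'" if pp: "p \<in> standardize Y" "p' \<in> standardize Y" "p \<noteq> p'" for p p'
    proof -
      obtain b b' where b: "b \<in> Y" "b' \<in> Y" "p = g ` b" "p' = g ` b'"
        using pp(1,2) unfolding std by (elim imageE) iprover
      then have "b \<noteq> b'" using pp(3) by auto
      moreover have "b \<in> P" "b' \<in> P" using b Y by auto
      ultimately have "b \<inter> b' = {}" using disjointD[OF dj] by metis
      then have "g ` b \<inter> g ` b' = {}"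
        using inj_on_image_Int[OF inj sub[OF b(1)] sub[OF b(2)]] by simp
      then show ?thesis using b by (simp add: disjnt_def)
    qed
  qed
  moreover have "noncrossing (standardize Y)"
    unfolding noncrossing_def
  proof
    assume "\<exists>b\<in>standardize Y. \<exists>b'\<in>standardize Y. b \<noteq> b' \<and>
      (\<exists>x\<in>b. \<exists>y\<in>b'. \<exists>z\<in>b. \<exists>t\<in>b'. x < y \<and> y < z \<and> z < t)"
    then obtain p p' x' y' z' t' where p: "p \<in> standardize Y" "p' \<in> standardize Y" "p \<noteq> p'"
      "x' \<in> p" "y' \<in> p'" "z' \<in> p" "t' \<in> p'" "x' < y'" "y' < z'" "z' < t'"
      by (elim bexE conjE) iprover
    obtain b b' where b: "b \<in> Y" "p = g ` b" "b' \<in> Y" "p' = g ` b'"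
      using p(1,2) unfolding std by (elim imageE) iprover
    obtain x y z t where h: "x \<in> b" "y \<in> b'" "z \<in> b" "t \<in> b'"
      "x' = g x" "y' = g y" "z' = g z" "t' = g t"
      using p(4-7) unfolding b(2) b(4) by (elim imageE) iprover
    have S: "x \<in> S" "y \<in> S" "z \<in> S" "t \<in> S"
      using h(1-4) sub[OF b(1)] sub[OF b(3)] by auto
    have "x < y" "y < z" "z < t"
      using mono[OF _ S(1,2)] mono[OF _ S(2,3)] mono[OF _ S(3,4)] p(8-10) unfolding h(5-8) by auto
    moreover have "b \<noteq> b'" using b(2,4) p(3) by auto
    moreover have "b \<in> P" "b' \<in> P" using b Y by auto
    ultimately show False using nc h(1-4) unfolding noncrossing_def by metis
  qed
  ultimately show ?thesis unfolding is_ncp_def using c1 by blast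
qed

lemma is_ncp_quotient_blocks:
  assumes P: "is_ncp P" and r: "r \<in> admissible P"
  shows "is_ncp (quotient_blocks P r)"
proof -
  obtain n where n: "n \<ge> 1" "partition_on {1..n} P"
    using P unfolding is_ncp_def by blast
  have eq: "equiv P r" and nc: "noncrossing (quotient_blocks P r)"
    using r unfolding admissible_def by auto
  have dj: "disjoint P" and ne: "{} \<notin> P" and U: "\<Union>P = {1..n}"
    using n unfolding partition_on_def by auto
  have "partition_on {1..n} (quotient_blocks P r)"
  proof (rule partition_onI)
    have "\<Union>(quotient_blocks P r) = \<Union>(\<Union>(P // r))" unfolding quotient_blocks_def by blast
    then show "\<Union>(quotient_blocks P r) = {1..n}" using Union_quotient[OF eq] U by simp
    have "p \<noteq> {}" if p: "p \<in> quotient_blocks P r" for p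
    proof -
      obtain C where C: "C \<in> P // r" "p = \<Union>C" using p unfolding quotient_blocks_def by blast
      obtain c where c: "c \<in> C" using in_quotient_imp_non_empty[OF eq C(1)] by auto
      then have "c \<in> P" using in_quotient_imp_subset[OF eq C(1)] by auto
      then have "c \<noteq> {}" using ne by metis
      then show ?thesis using c C(2) by auto
    qed
    then show "{} \<notin> quotient_blocks P r" by metis
    show "disjnt p p'"
      if p: "p \<in> quotient_blocks P r" "p' \<in> quotient_blocks P r" "p \<noteq> p'" for p p'
    proof -
      obtain C C' where C: "C \<in> P // r" "p = \<Union>C" "C' \<in> P // r" "p' = \<Union>C'"
        using p unfolding quotient_blocks_def by blast
      have CC: "C \<inter> C' = {}" using quotient_disj[OF eq C(1) C(3)] p(3) C(2,4) by metis
      have sub: "C \<subseteq> P" "C' \<subseteq> P"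
        using in_quotient_imp_subset[OF eq C(1)] in_quotient_imp_subset[OF eq C(3)] .
      have "x \<inter> x' = {}" if x: "x \<in> C" "x' \<in> C'" for x x'
      proof -
        have "x \<in> P" "x' \<in> P" "x \<noteq> x'" using x sub CC by auto
        then show ?thesis using disjointD[OF dj] by metis
      qed
      then show ?thesis unfolding C(2) C(4) disjnt_def by fast
    qed
  qed
  then show ?thesis unfolding is_ncp_def using n nc by blast
qed

end

theory Submission
  imports Defs
begin

text \<open>For a noncrossing partition \<open>\<pi>\<close> with \<open>n\<close> blocks write \<open>le(\<pi>)\<close> for its number of linear extensions.
Evaluate the second tensor factor of the identity \<open>\<Delta> \<circ> \<phi> = (\<phi> \<otimes> \<phi>) \<circ> \<Delta>\<close> at \<open>1\<close>. On \<open>\<phi>(x)\<close> this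
evaluation is the counit of \<open>\<delta>\<close>, which is multiplicative and singles out the partitions with one
block; hence \<open>\<phi>(\<pi>)(X + 1)\<close> is the sum of the polynomials \<open>\<phi>(\<pi> without J)\<close> over those ideals \<open>J\<close> in
which every maximal run of consecutive integers is a single block (\<open>shift_phi_gen\<close> and
\<open>weight_eq_prod\<close>). Such a \<open>J\<close> is a set of leaves, that is, of blocks with no block nested inside, and
no two of them follow one another immediately.

Comparing coefficients, only the ideals with at most two blocks matter for the two highest
coefficients \<open>a(\<pi>)\<close> and \<open>b(\<pi>)\<close> of \<open>\<phi>(\<pi>)\<close>. With \<open>l\<close> ranging over leaves and \<open>{l, l'}\<close> over pairs of
leaves separated by some element of another block, this gives
\<open>n a(\<pi>) = \<Sum> a(\<pi> - l)\<close> and \<open>binom(n, 2) a(\<pi>) + (n - 1) b(\<pi>) = \<Sum> b(\<pi> - l) + \<Sum> a(\<pi> - l - l')\<close>.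
The first recursion is solved by \<open>a = le / n!\<close>, since the block with the largest value in a
linear extension is an arbitrary leaf (\<open>num_lin_ext_rec\<close>).

For the second one, let \<open>B(\<pi>)\<close> be the sum of \<open>le\<close> over the merges of close pairs plus half the sum
over the merges of nested pairs; the claim is \<open>b = - B / (n - 1)!\<close>. Again look at the block on top
of a linear extension of a merge: either it is a leaf of \<open>\<pi>\<close> outside the pair, or it is the merged
block. The first case contributes \<open>\<Sum> B(\<pi> - l)\<close>. The second one happens exactly for two leaves that
touch, and for a block whose only inner block is the other one (a twig). On the other hand, the
two largest values of a linear extension of \<open>\<pi>\<close> itself are taken at two leaves, in either order,
or at the two blocks of a twig, so \<open>le(\<pi>) / 2\<close> is the sum of \<open>le(\<pi> - l - l')\<close> over all unordered
pairs of leaves plus half the same sum over twigs. The difference of the two counts is the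
separated pairs of leaves: \<open>B(\<pi>) = \<Sum> B(\<pi> - l) + le(\<pi>) / 2 - \<Sum> le(\<pi> - l - l')\<close>
(\<open>pair_sum_rec\<close>), which is the recursion for \<open>b\<close>.

Removing blocks destroys the numbering by consecutive integers. The combinatorial part is therefore
carried out for arbitrary noncrossing families of blocks, with a description of close pairs that
only refers to the order of the elements (\<open>sibling_pairs\<close>), and transported along strictly
increasing relabellings.\<close>

section \<open>Noncrossing families of blocks\<close>

definition nc_family :: "nat set set \<Rightarrow> bool" where
  "nc_family Y \<longleftrightarrow> finite Y \<and> (\<forall>b\<in>Y. finite b \<and> b \<noteq> {}) \<and> disjoint Y \<and> noncrossing Y"

lemma nc_family_subset: "nc_family Y \<Longrightarrow> Z \<subseteq> Y \<Longrightarrow> nc_family Z"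
  unfolding nc_family_def noncrossing_def disjoint_def
  by (meson finite_subset pairwise_subset subsetD)

lemma nest_le_iff:
  assumes "finite b" "b \<noteq> {}" "finite c" "c \<noteq> {}"
  shows "nest_le b c \<longleftrightarrow> Min b \<le> Min c \<and> Max c \<le> Max b"
  using assms unfolding nest_le_def by (auto simp: subset_iff)

lemma nest_le_refl: "finite b \<Longrightarrow> nest_le b b"
  unfolding nest_le_def by auto

context
  fixes Y :: "nat set set"
  assumes Y: "nc_family Y"
begin

lemma block_finite: "b \<in> Y \<Longrightarrow> finite b" and block_nonempty: "b \<in> Y \<Longrightarrow> b \<noteq> {}"
  using Y unfolding nc_family_def by auto

lemma family_finite: "finite Y"
  using Y unfolding nc_family_def by auto

lemma block_unique: "b \<in> Y \<Longrightarrow> c \<in> Y \<Longrightarrow> x \<in> b \<Longrightarrow> x \<in> c \<Longrightarrow> b = c"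
  using Y unfolding nc_family_def disjoint_def pairwise_def disjnt_def by blast

lemma block_Min_in: "b \<in> Y \<Longrightarrow> Min b \<in> b" and block_Max_in: "b \<in> Y \<Longrightarrow> Max b \<in> b"
  using block_finite block_nonempty by auto

lemma block_Min_le: "b \<in> Y \<Longrightarrow> x \<in> b \<Longrightarrow> Min b \<le> x" and block_Max_ge: "b \<in> Y \<Longrightarrow> x \<in> b \<Longrightarrow> x \<le> Max b"
  using block_finite by auto

lemma block_Min_le_Max: "b \<in> Y \<Longrightarrow> Min b \<le> Max b"
  using block_Min_in block_Max_ge by blast

lemma block_nest_le_iff:
  "b \<in> Y \<Longrightarrow> c \<in> Y \<Longrightarrow> nest_le b c \<longleftrightarrow> Min b \<le> Min c \<and> Max c \<le> Max b"
  by (simp add: nest_le_iff block_finite block_nonempty)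

lemma block_eq_of_Min_eq: "b \<in> Y \<Longrightarrow> c \<in> Y \<Longrightarrow> Min b = Min c \<Longrightarrow> b = c"
  by (metis block_Min_in block_unique)

lemma nest_le_antisym: "b \<in> Y \<Longrightarrow> c \<in> Y \<Longrightarrow> nest_le b c \<Longrightarrow> nest_le c b \<Longrightarrow> b = c"
  by (simp add: block_nest_le_iff block_eq_of_Min_eq)

text \<open>A block reaching both inside and outside the range of another block would cross it.\<close>
lemma nest_le_of_mem_range:
  assumes b: "b \<in> Y" and c: "c \<in> Y" and x: "x \<in> c" "Min b \<le> x" "x \<le> Max b"
  shows "nest_le b c"
proof (cases "b = c")
  case True
  then show ?thesis using nest_le_refl block_finite b by blast
next
  case False
  have nc: "noncrossing Y" using Y unfolding nc_family_def by blast
  have "x \<noteq> Min b" "x \<noteq> Max b"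
    using False block_unique[OF b c] x(1) block_Min_in[OF b] block_Max_in[OF b] by auto
  then have strict: "Min b < x" "x < Max b" using x by auto
  have "y \<in> {Min b..Max b}" if y: "y \<in> c" for y
  proof (rule ccontr)
    assume "y \<notin> {Min b..Max b}"
    then consider "y < Min b" | "Max b < y" by fastforce
    then show False
      using nc strict b c x(1) y False block_Min_in[OF b] block_Max_in[OF b]
      unfolding noncrossing_def by cases metis+
  qed
  then show ?thesis unfolding nest_le_def by blast
qed

lemma block_trichotomy:
  assumes "b \<in> Y" "c \<in> Y"
  shows "nest_le b c \<or> nest_le c b \<or> Max b < Min c \<or> Max c < Min b"
proof (rule ccontr)
  assume "\<not> ?thesis"
  then have h: "\<not> nest_le b c" "\<not> nest_le c b" "Min c \<le> Max b" "Min b \<le> Max c" by auto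
  then show False
    using nest_le_of_mem_range[OF assms block_Min_in[OF assms(2)]]
      nest_le_of_mem_range[OF assms(2,1) block_Min_in[OF assms(1)]] by linarith
qed

end

section \<open>Linear extensions and leaves\<close>

definition leaves :: "nat set set \<Rightarrow> nat set set" where
  "leaves Y = {l \<in> Y. \<forall>c\<in>Y. nest_le l c \<longrightarrow> c = l}"

definition lin_exts :: "nat set set \<Rightarrow> (nat set \<Rightarrow> nat) set" where
  "lin_exts Y = {f \<in> Y \<rightarrow>\<^sub>E {1..card Y}.
     bij_betw f Y {1..card Y} \<and> (\<forall>b\<in>Y. \<forall>b'\<in>Y. nest_le b b' \<longrightarrow> f b \<le> f b')}"

lemma finite_lin_exts: "finite Y \<Longrightarrow> finite (lin_exts Y)"
  unfolding lin_exts_def by (rule finite_subset[OF _ finite_PiE[of Y "\<lambda>_. {1..card Y}"]]) auto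

text \<open>The largest value of a linear extension is taken at a leaf, and every leaf can take it.\<close>
lemma num_lin_ext_rec:
  assumes fin: "finite Y" and ne: "Y \<noteq> {}"
  shows "num_lin_ext Y = (\<Sum>l\<in>leaves Y. num_lin_ext (Y - {l}))"
proof -
  define n where "n = card Y"
  have n: "n \<ge> 1" using fin ne unfolding n_def by (simp add: Suc_le_eq card_gt_0_iff)
  define A where "A l = {f \<in> lin_exts Y. f l = n}" for l
  have num: "num_lin_ext Z = card (lin_exts Z)" for Z
    unfolding num_lin_ext_def lin_exts_def ..
  have inj: "inj_on f Y" if "f \<in> lin_exts Y" for f
    using that unfolding lin_exts_def bij_betw_def by auto
  have un: "lin_exts Y = (\<Union>l\<in>leaves Y. A l)"
  proof
    show "(\<Union>l\<in>leaves Y. A l) \<subseteq> lin_exts Y" unfolding A_def by auto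
    show "lin_exts Y \<subseteq> (\<Union>l\<in>leaves Y. A l)"
    proof
      fix f assume f: "f \<in> lin_exts Y"
      have img: "f ` Y = {1..n}" using f unfolding lin_exts_def bij_betw_def n_def by auto
      then obtain l where l: "l \<in> Y" "f l = n" using n by (metis atLeastAtMost_iff imageE order_refl)
      have "c = l" if c: "c \<in> Y" "nest_le l c" for c
      proof -
        have "f l \<le> f c" using f l c unfolding lin_exts_def by auto
        moreover have "f c \<le> n" using img c by auto
        ultimately show ?thesis using l c inj[OF f] by (metis antisym inj_onD)
      qed
      then have "l \<in> leaves Y" using l unfolding leaves_def by blast
      then show "f \<in> (\<Union>l\<in>leaves Y. A l)" using l f unfolding A_def by blast
    qed
  qed
  have cardA: "card (A l) = num_lin_ext (Y - {l})" if l: "l \<in> leaves Y" for l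
  proof -
    have lY: "l \<in> Y" and lf: "\<And>c. c \<in> Y \<Longrightarrow> nest_le l c \<Longrightarrow> c = l"
      using l unfolding leaves_def by auto
    have cm: "card (Y - {l}) = n - 1" using lY fin unfolding n_def by simp
    have Yl: "Y = insert l (Y - {l})" using lY by auto
    have intv: "{1..n} = insert n {1..n-1}" using n by auto
    have "bij_betw (\<lambda>f. f(l := n)) (lin_exts (Y - {l})) (A l)"
    \<comment> \<open>Elements of \<open>lin_exts Z\<close> take the value \<open>undefined\<close> outside \<open>Z\<close>, so the inverse resets \<open>l\<close> to it.\<close>
    proof (rule bij_betw_byWitness[where f' = "\<lambda>f. f(l := undefined)"])
      show "\<forall>f\<in>lin_exts (Y - {l}). (f(l := n))(l := undefined) = f"
        unfolding lin_exts_def by (auto simp: PiE_def extensional_def fun_eq_iff)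
      show "\<forall>f\<in>A l. (f(l := undefined))(l := n) = f"
        unfolding A_def by auto
      show "(\<lambda>f. f(l := n)) ` lin_exts (Y - {l}) \<subseteq> A l"
      proof
        fix h assume "h \<in> (\<lambda>f. f(l := n)) ` lin_exts (Y - {l})"
        then obtain f where f: "f \<in> lin_exts (Y - {l})" and h: "h = f(l := n)" by blast
        have fE: "f \<in> (Y - {l}) \<rightarrow>\<^sub>E {1..n-1}" and fb: "bij_betw f (Y - {l}) {1..n-1}"
          and fo: "\<And>b c. b \<in> Y - {l} \<Longrightarrow> c \<in> Y - {l} \<Longrightarrow> nest_le b c \<Longrightarrow> f b \<le> f c"
          using f unfolding lin_exts_def cm by auto
        have "h \<in> Y \<rightarrow>\<^sub>E {1..n}"
          using fE lY n unfolding h by (auto simp: PiE_def extensional_def Pi_def)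
        moreover have "bij_betw h Y {1..n}"
        proof -
          have "bij_betw h (Y - {l}) {1..n-1}"
            using fb by (rule bij_betw_cong[THEN iffD1, rotated]) (simp add: h)
          then have "bij_betw h (Y - {l} \<union> {l}) ({1..n-1} \<union> {n})"
            by (intro bij_betw_combine) (use n in \<open>auto simp: h\<close>)
          then show ?thesis using Yl intv by (metis Un_insert_right sup_bot_right)
        qed
        moreover have "h b \<le> h c" if "b \<in> Y" "c \<in> Y" "nest_le b c" for b c
        proof (cases "c = l")
          case True
          then show ?thesis using \<open>h \<in> Y \<rightarrow>\<^sub>E {1..n}\<close> that(1) by (auto simp: h PiE_def Pi_def split: if_splits)
        next
          case False
          then have "b \<noteq> l" using lf that by blast
          then show ?thesis using fo False that by (simp add: h)
        qed
        ultimately show "h \<in> A l" unfolding A_def lin_exts_def n_def[symmetric] by (simp add: h)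
      qed
      show "(\<lambda>f. f(l := undefined)) ` A l \<subseteq> lin_exts (Y - {l})"
      proof
        fix h assume "h \<in> (\<lambda>f. f(l := undefined)) ` A l"
        then obtain f where f: "f \<in> lin_exts Y" "f l = n" and h: "h = f(l := undefined)"
          unfolding A_def by blast
        have fE: "f \<in> Y \<rightarrow>\<^sub>E {1..n}" and fb: "bij_betw f Y {1..n}"
          and fo: "\<And>b c. b \<in> Y \<Longrightarrow> c \<in> Y \<Longrightarrow> nest_le b c \<Longrightarrow> f b \<le> f c"
          using f unfolding lin_exts_def n_def by auto
        have "bij_betw f (Y - {l}) ({1..n} - {f l})"
          using fb lY unfolding bij_betw_def by (auto simp: inj_on_def)
        moreover have "{1..n} - {f l} = {1..n-1}" using f(2) by auto
        ultimately have hb: "bij_betw h (Y - {l}) {1..n-1}"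
          by (metis (no_types, lifting) DiffD2 bij_betw_cong fun_upd_other h singletonI)
        moreover have "h \<in> (Y - {l}) \<rightarrow>\<^sub>E {1..n-1}"
          using bij_betw_imp_funcset[OF hb] fE by (auto simp: h PiE_def extensional_def)
        ultimately show "h \<in> lin_exts (Y - {l})"
          using fo unfolding lin_exts_def cm by (auto simp: h)
      qed
    qed
    then show ?thesis unfolding num by (metis bij_betw_same_card)
  qed
  have "card (\<Union>l\<in>leaves Y. A l) = (\<Sum>l\<in>leaves Y. card (A l))"
  proof (rule card_UN_disjoint)
    show "finite (leaves Y)" using fin unfolding leaves_def by auto
    show "\<forall>l\<in>leaves Y. finite (A l)" using finite_lin_exts[OF fin] unfolding A_def by auto
    show "\<forall>l\<in>leaves Y. \<forall>l'\<in>leaves Y. l \<noteq> l' \<longrightarrow> A l \<inter> A l' = {}"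
      using inj unfolding A_def leaves_def by (auto dest: inj_onD)
  qed
  then show ?thesis unfolding num[of Y] un using cardA by simp
qed

lemma num_lin_ext_empty: "num_lin_ext {} = 1"
  unfolding num_lin_ext_def by (simp add: bij_betw_def)

text \<open>The block with the largest minimum contains no other block.\<close>
lemma leaves_nonempty:
  assumes Y: "nc_family Y" and ne: "Y \<noteq> {}"
  shows "leaves Y \<noteq> {}"
proof -
  have "Max (Min ` Y) \<in> Min ` Y" using family_finite[OF Y] ne by auto
  then obtain l where l: "l \<in> Y" "Min l = Max (Min ` Y)" by auto
  have "c = l" if c: "c \<in> Y" "nest_le l c" for c
  proof -
    have "Min c \<le> Min l" using l c family_finite[OF Y] by simp
    then show ?thesis
      using c l block_nest_le_iff[OF Y l(1) c(1)] block_eq_of_Min_eq[OF Y] by (metis le_antisym)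
  qed
  then show ?thesis using l unfolding leaves_def by blast
qed

lemma num_lin_ext_pos: "nc_family Y \<Longrightarrow> num_lin_ext Y > 0"
proof (induction "card Y" arbitrary: Y)
  case 0
  then show ?case using num_lin_ext_empty family_finite by fastforce
next
  case (Suc n)
  have fin: "finite Y" using family_finite[OF Suc.prems] .
  have ne: "Y \<noteq> {}" using Suc.hyps by auto
  obtain l where l: "l \<in> leaves Y" using leaves_nonempty[OF Suc.prems ne] by auto
  then have lY: "l \<in> Y" unfolding leaves_def by auto
  have "0 < num_lin_ext (Y - {l})"
    by (rule Suc.hyps(1)) (use Suc.hyps(2) lY fin nc_family_subset[OF Suc.prems] in auto)
  moreover have "finite (leaves Y)" using fin unfolding leaves_def by auto
  ultimately show ?case
    using num_lin_ext_rec[OF fin ne] l by (metis neq0_conv sum_eq_0_iff)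
qed

section \<open>Merging close and nested pairs\<close>

definition gap :: "nat set \<Rightarrow> nat set \<Rightarrow> nat set" where
  "gap b c = {Max b<..<Min c}"

text \<open>The elements between \<open>b\<close> and \<open>c\<close> form a union of blocks. In a partition of an interval
of integers these are the close pairs (see \<open>close_pairs_eq_sibling_pairs\<close>), but unlike the
condition \<open>Max b + 1 = Min c\<close> this one survives the removal of blocks.\<close>
definition sibling_pairs :: "nat set set \<Rightarrow> (nat set \<times> nat set) set" where
  "sibling_pairs Y = {(b, c). b \<in> Y \<and> c \<in> Y \<and> Max b < Min c \<and>
     (\<forall>d\<in>Y. d \<inter> gap b c \<noteq> {} \<longrightarrow> d \<subseteq> gap b c)}"

definition leaf_pairs :: "nat set set \<Rightarrow> (nat set \<times> nat set) set" where
  "leaf_pairs Y = {(b, c). b \<in> leaves Y \<and> c \<in> leaves Y \<and> Max b < Min c}"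

definition touching :: "nat set set \<Rightarrow> nat set \<times> nat set \<Rightarrow> bool" where
  "touching Y = (\<lambda>(b, c). \<Union>Y \<inter> gap b c = {})"

text \<open>A block \<open>b\<close> with exactly one block \<open>c\<close> inside, described through the order in which the two
become leaves.\<close>
definition twig_pairs :: "nat set set \<Rightarrow> (nat set \<times> nat set) set" where
  "twig_pairs Y = {(b, c). c \<in> leaves Y \<and> b \<in> leaves (Y - {c}) \<and> b \<notin> leaves Y}"

context
  fixes Y :: "nat set set"
  assumes Y: "nc_family Y"
begin

lemma leaf_in: "l \<in> leaves Y \<Longrightarrow> l \<in> Y"
  unfolding leaves_def by auto

text \<open>A leaf cannot enclose \<open>b\<close> or \<open>c\<close>, so a leaf that meets the gap between them lies inside it
and its removal makes no new pair close.\<close>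
lemma sibling_pairs_remove_leaf:
  assumes l: "l \<in> leaves Y"
  shows "sibling_pairs (Y - {l}) = {(b, c) \<in> sibling_pairs Y. b \<noteq> l \<and> c \<noteq> l}"
proof -
  have lY: "l \<in> Y" using leaf_in[OF l] .
  have key: "l \<subseteq> gap b c"
    if b: "b \<in> Y" "b \<noteq> l" and c: "c \<in> Y" "c \<noteq> l" and lt: "Max b < Min c" and meet: "l \<inter> gap b c \<noteq> {}" for b c
  proof -
    obtain z where z: "z \<in> l" "Max b < z" "z < Min c" using meet unfolding gap_def by auto
    have nb: "\<not> nest_le l b" "\<not> nest_le l c" using l b c unfolding leaves_def by auto
    have "Max b < Min l"
      using block_trichotomy[OF Y lY b(1)] nb z block_Min_le[OF Y lY z(1)] block_Max_ge[OF Y lY z(1)]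
        block_Min_le_Max[OF Y b(1)] block_nest_le_iff[OF Y b(1) lY] by auto
    moreover have "Max l < Min c"
      using block_trichotomy[OF Y lY c(1)] nb z block_Min_le[OF Y lY z(1)] block_Max_ge[OF Y lY z(1)]
        block_Min_le_Max[OF Y c(1)] block_nest_le_iff[OF Y c(1) lY] by auto
    ultimately show ?thesis
      unfolding gap_def using block_Min_le[OF Y lY] block_Max_ge[OF Y lY] by fastforce
  qed
  have "(b, c) \<in> sibling_pairs (Y - {l}) \<longleftrightarrow> (b, c) \<in> sibling_pairs Y \<and> b \<noteq> l \<and> c \<noteq> l" for b c
  proof (cases "b \<in> Y \<and> c \<in> Y \<and> b \<noteq> l \<and> c \<noteq> l \<and> Max b < Min c")
    case True
    define Q where "Q d \<longleftrightarrow> d \<inter> gap b c \<noteq> {} \<longrightarrow> d \<subseteq> gap b c" for d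
    have "Q l" using key True unfolding Q_def by metis
    then have "(\<forall>d\<in>Y - {l}. Q d) \<longleftrightarrow> (\<forall>d\<in>Y. Q d)" by blast
    then show ?thesis using True unfolding sibling_pairs_def Q_def by simp
  next
    case False
    then show ?thesis unfolding sibling_pairs_def by auto
  qed
  then show ?thesis by auto
qed

lemma nested_pairs_remove_leaf:
  assumes l: "l \<in> leaves Y"
  shows "nested_pairs (Y - {l}) = {(b, c) \<in> nested_pairs Y. b \<noteq> l \<and> c \<noteq> l}"
  using l unfolding nested_pairs_def leaves_def by auto

lemma merged_notin:
  assumes "b \<in> Y" "c \<in> Y" "b \<noteq> c"
  shows "b \<union> c \<notin> Y"
  using assms block_unique[OF Y] block_nonempty[OF Y] by blast

lemma merge_pair_remove:
  assumes "b \<in> Y" "c \<in> Y" "l \<in> Y" "b \<noteq> c" "l \<noteq> b" "l \<noteq> c"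
  shows "merge_pair Y (b, c) - {l} = merge_pair (Y - {l}) (b, c)"
  using assms merged_notin[OF assms(1,2,4)] unfolding merge_pair_def by auto

lemma merge_pair_remove_merged:
  assumes "b \<in> Y" "c \<in> Y" "b \<noteq> c"
  shows "merge_pair Y (b, c) - {b \<union> c} = Y - {b, c}"
  using merged_notin[OF assms] unfolding merge_pair_def by auto

lemma Min_union_block: "b \<in> Y \<Longrightarrow> c \<in> Y \<Longrightarrow> Min (b \<union> c) = min (Min b) (Min c)"
  and Max_union_block: "b \<in> Y \<Longrightarrow> c \<in> Y \<Longrightarrow> Max (b \<union> c) = max (Max b) (Max c)"
  using block_finite[OF Y] block_nonempty[OF Y] by (auto intro: Min_Un Max_Un)

lemma nest_le_union_iff:
  "nest_le d (b \<union> c) \<longleftrightarrow> nest_le d b \<and> nest_le d c"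
  unfolding nest_le_def by auto

lemma merged_nest_le_iff_nested:
  assumes "b \<in> Y" "c \<in> Y" "nest_le b c"
  shows "nest_le (b \<union> c) d \<longleftrightarrow> nest_le b d"
proof -
  have "Min (b \<union> c) = Min b" "Max (b \<union> c) = Max b"
    using assms(3) Min_union_block[OF assms(1,2)] Max_union_block[OF assms(1,2)]
    unfolding block_nest_le_iff[OF Y assms(1,2)] by auto
  then show ?thesis unfolding nest_le_def by simp
qed

lemma merged_nest_le_iff_sibling:
  assumes "b \<in> Y" "c \<in> Y" "Max b < Min c"
  shows "nest_le (b \<union> c) d \<longleftrightarrow> d \<subseteq> {Min b..Max c}"
proof -
  have "Min (b \<union> c) = Min b" "Max (b \<union> c) = Max c"
    using assms(3) Min_union_block[OF assms(1,2)] Max_union_block[OF assms(1,2)]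
      block_Min_le_Max[OF Y assms(1)] block_Min_le_Max[OF Y assms(2)] by auto
  then show ?thesis unfolding nest_le_def by simp
qed

text \<open>An enclosing block of only one of the two would have an element in the gap and another
one outside. Hence the blocks below the merged block are those below either part.\<close>
lemma nest_le_sibling_iff:
  assumes p: "(b, c) \<in> sibling_pairs Y" and d: "d \<in> Y" "d \<noteq> b" "d \<noteq> c"
  shows "nest_le d b \<longleftrightarrow> nest_le d c"
proof -
  have b: "b \<in> Y" and c: "c \<in> Y" and lt: "Max b < Min c"
    and cl0: "d \<inter> gap b c \<noteq> {} \<longrightarrow> d \<subseteq> gap b c"
    using p d(1) unfolding sibling_pairs_def by auto
  have cl: "d \<subseteq> gap b c" if "z \<in> d" "Max b < z" "z < Min c" for z
    using cl0 that unfolding gap_def by (meson disjoint_iff greaterThanLessThan_iff)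
  have mM: "Min d \<in> d" "Max d \<in> d" using block_Min_in[OF Y d(1)] block_Max_in[OF Y d(1)] .
  have "Max b \<notin> d" "Min c \<notin> d"
    using block_unique[OF Y d(1) b _ block_Max_in[OF Y b]] block_unique[OF Y d(1) c _ block_Min_in[OF Y c]] d(2,3)
    by metis+
  then have "Max d \<noteq> Max b" "Max d \<noteq> Min c" "Min d \<noteq> Max b" "Min d \<noteq> Min c"
    using mM by metis+
  moreover have "\<not> (Max b < Max d \<and> Max d < Min c \<and> Min d < Max b)"
    using subsetD[OF cl[OF mM(2)] mM(1)] unfolding gap_def by auto
  moreover have "\<not> (Max b < Min d \<and> Min d < Min c \<and> Min c < Max d)"
    using subsetD[OF cl[OF mM(1)] mM(2)] unfolding gap_def by auto
  ultimately show ?thesis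
    using block_trichotomy[OF Y d(1) b] block_trichotomy[OF Y d(1) c] lt
      block_Min_le_Max[OF Y b] block_Min_le_Max[OF Y c] block_Min_le_Max[OF Y d(1)]
    unfolding block_nest_le_iff[OF Y d(1) b] block_nest_le_iff[OF Y d(1) c]
      block_nest_le_iff[OF Y b d(1)] block_nest_le_iff[OF Y c d(1)]
    by (elim disjE) auto
qed

text \<open>The blocks around \<open>c\<close> form a chain, and none of them lies strictly between \<open>b\<close> and \<open>c\<close>.\<close>
lemma nested_pair_below:
  assumes p: "(b, c) \<in> nested_pairs Y" and d: "d \<in> Y" "d \<noteq> b" "d \<noteq> c"
  shows "nest_le d b \<longleftrightarrow> nest_le d c"
proof -
  have b: "b \<in> Y" and c: "c \<in> Y" and bc: "nest_le b c"
    and cov: "\<not> (nest_le b d \<and> nest_le d c)"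
    using p d unfolding nested_pairs_def by auto
  show ?thesis
    using block_trichotomy[OF Y d(1) b] bc cov
      block_Min_le_Max[OF Y b] block_Min_le_Max[OF Y c] block_Min_le_Max[OF Y d(1)]
    unfolding block_nest_le_iff[OF Y d(1) b] block_nest_le_iff[OF Y d(1) c] block_nest_le_iff[OF Y b c]
      block_nest_le_iff[OF Y b d(1)]
    by (elim disjE) auto
qed

lemma leaf_merge_iff:
  assumes p: "(b, c) \<in> sibling_pairs Y \<union> nested_pairs Y" and d: "d \<in> Y" "d \<noteq> b" "d \<noteq> c"
  shows "d \<in> leaves (merge_pair Y (b, c)) \<longleftrightarrow> d \<in> leaves Y"
proof -
  have b: "b \<in> Y" and c: "c \<in> Y"
    using p unfolding sibling_pairs_def nested_pairs_def by auto
  have eq: "nest_le d b \<longleftrightarrow> nest_le d c"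
    using p nest_le_sibling_iff nested_pair_below d by blast
  have dm: "d \<noteq> b \<union> c"
  proof
    assume "d = b \<union> c"
    then have "Min b \<in> d" using block_Min_in[OF Y b] by simp
    then show False using block_unique[OF Y d(1) b _ block_Min_in[OF Y b]] d(2) by blast
  qed
  have "d \<in> leaves (merge_pair Y (b, c)) \<longleftrightarrow>
      \<not> nest_le d (b \<union> c) \<and> (\<forall>e\<in>Y - {b, c}. nest_le d e \<longrightarrow> e = d)"
    using d dm unfolding leaves_def merge_pair_def by auto
  also have "\<dots> \<longleftrightarrow> (\<forall>e\<in>Y. nest_le d e \<longrightarrow> e = d)"
    unfolding nest_le_union_iff using eq d b c by auto
  finally show ?thesis using d unfolding leaves_def by auto
qed

lemma sibling_pairs_distinct:
  assumes "(b, c) \<in> sibling_pairs Y"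
  shows "b \<noteq> c"
proof
  assume "b = c"
  then have "b \<in> Y" "Max b < Min b" using assms unfolding sibling_pairs_def by auto
  then show False using block_Min_le_Max[OF Y] by fastforce
qed

text \<open>The top block of a linear extension of the merged family is either a leaf of \<open>Y\<close> outside the
pair or the merged block itself.\<close>
lemma num_lin_ext_merge_rec:
  assumes p: "(b, c) \<in> sibling_pairs Y \<union> nested_pairs Y"
  shows "num_lin_ext (merge_pair Y (b, c)) =
    (\<Sum>l\<in>leaves Y - {b, c}. num_lin_ext (merge_pair (Y - {l}) (b, c))) +
    (if b \<union> c \<in> leaves (merge_pair Y (b, c)) then num_lin_ext (Y - {b, c}) else 0)"
proof -
  have b: "b \<in> Y" and c: "c \<in> Y"
    using p unfolding sibling_pairs_def nested_pairs_def by auto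
  have bc: "b \<noteq> c"
    using p sibling_pairs_distinct[of b c] by (auto simp: nested_pairs_def)
  let ?M = "merge_pair Y (b, c)"
  have fin: "finite ?M" "?M \<noteq> {}" using family_finite[OF Y] unfolding merge_pair_def by auto
  have finl: "finite (leaves Y)" using family_finite[OF Y] unfolding leaves_def by auto
  have sub: "leaves ?M \<subseteq> insert (b \<union> c) (Y - {b, c})" unfolding leaves_def merge_pair_def by auto
  have lv: "leaves ?M = (leaves Y - {b, c}) \<union> (if b \<union> c \<in> leaves ?M then {b \<union> c} else {})"
  proof -
    have e1: "d \<in> leaves ?M \<longleftrightarrow> d \<in> leaves Y - {b, c}" if "d \<noteq> b \<union> c" for d
    proof (cases "d \<in> Y - {b, c}")
      case True
      then show ?thesis using leaf_merge_iff[OF p, of d] by simp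
    next
      case False
      then show ?thesis using sub leaf_in that by blast
    qed
    have e2: "b \<union> c \<notin> leaves Y" using leaf_in merged_notin[OF b c bc] by blast
    have gen: "A = B \<union> (if x \<in> A then {x} else {})"
      if "\<And>d. d \<noteq> x \<Longrightarrow> d \<in> A \<longleftrightarrow> d \<in> B" "x \<notin> B" for A B :: "nat set set" and x
    proof (rule set_eqI)
      fix d
      show "d \<in> A \<longleftrightarrow> d \<in> B \<union> (if x \<in> A then {x} else {})"
        using that(1)[of d] that(2) by (cases "d = x") simp_all
    qed
    show ?thesis by (rule gen[OF e1]) (use e2 in simp_all)
  qed
  have "num_lin_ext ?M = (\<Sum>l\<in>leaves ?M. num_lin_ext (?M - {l}))"
    by (rule num_lin_ext_rec[OF fin])
  also have "\<dots> = (\<Sum>l\<in>leaves Y - {b, c}. num_lin_ext (?M - {l})) +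
     (\<Sum>l\<in>(if b \<union> c \<in> leaves ?M then {b \<union> c} else {}). num_lin_ext (?M - {l}))"
    by (subst lv, rule sum.union_disjoint) (use finl merged_notin[OF b c bc] leaf_in[of "b \<union> c"] in auto)
  also have "(\<Sum>l\<in>leaves Y - {b, c}. num_lin_ext (?M - {l})) =
      (\<Sum>l\<in>leaves Y - {b, c}. num_lin_ext (merge_pair (Y - {l}) (b, c)))"
  proof (rule sum.cong[OF refl])
    fix l assume "l \<in> leaves Y - {b, c}"
    then have "?M - {l} = merge_pair (Y - {l}) (b, c)"
      by (intro merge_pair_remove[OF b c _ bc]) (use leaf_in in blast)+
    then show "num_lin_ext (?M - {l}) = num_lin_ext (merge_pair (Y - {l}) (b, c))" by simp
  qed
  also have "(\<Sum>l\<in>(if b \<union> c \<in> leaves ?M then {b \<union> c} else {}). num_lin_ext (?M - {l})) =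
     (if b \<union> c \<in> leaves ?M then num_lin_ext (Y - {b, c}) else 0)"
    using merge_pair_remove_merged[OF b c bc] by auto
  finally show ?thesis .
qed

text \<open>The merged block spans both parts and the gap between them, so it is a leaf only if the parts
are leaves and the gap is empty: blocks meeting the gap would lie inside it.\<close>
lemma merged_sibling_leaf_iff:
  "(b, c) \<in> sibling_pairs Y \<and> b \<union> c \<in> leaves (merge_pair Y (b, c)) \<longleftrightarrow>
   (b, c) \<in> leaf_pairs Y \<and> touching Y (b, c)" (is "?L \<longleftrightarrow> ?R")
proof
  assume L: ?L
  then have b: "b \<in> Y" and c: "c \<in> Y" and lt: "Max b < Min c"
    and cl: "\<And>d. d \<in> Y \<Longrightarrow> d \<inter> gap b c \<noteq> {} \<Longrightarrow> d \<subseteq> gap b c"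
    unfolding sibling_pairs_def by auto
  have lf: "d = b \<or> d = c" if d: "d \<in> Y" "d \<subseteq> {Min b..Max c}" for d
  proof (rule ccontr)
    assume n: "\<not> (d = b \<or> d = c)"
    have "d = b \<union> c"
      using L d n merged_nest_le_iff_sibling[OF b c lt, of d]
      unfolding leaves_def merge_pair_def by auto
    then show False using n b c d block_unique[OF Y] block_nonempty[OF Y] by blast
  qed
  note o = block_Min_le_Max[OF Y b] block_Min_le_Max[OF Y c]
  have "b \<in> leaves Y"
  proof -
    have "d = b" if d: "d \<in> Y" "nest_le b d" for d
    proof -
      have "d \<subseteq> {Min b..Max c}" using d(2) o lt unfolding nest_le_def by fastforce
      moreover have "d \<noteq> c" using d block_nest_le_iff[OF Y b c] o lt by auto
      ultimately show ?thesis using lf d by blast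
    qed
    then show ?thesis using b unfolding leaves_def by blast
  qed
  moreover have "c \<in> leaves Y"
  proof -
    have "d = c" if d: "d \<in> Y" "nest_le c d" for d
    proof -
      have "d \<subseteq> {Min b..Max c}" using d(2) o lt unfolding nest_le_def by fastforce
      moreover have "d \<noteq> b" using d block_nest_le_iff[OF Y c b] o lt by auto
      ultimately show ?thesis using lf d by blast
    qed
    then show ?thesis using c unfolding leaves_def by blast
  qed
  moreover have "\<Union>Y \<inter> gap b c = {}"
  proof (rule ccontr)
    assume "\<Union>Y \<inter> gap b c \<noteq> {}"
    then obtain d where d: "d \<in> Y" "d \<inter> gap b c \<noteq> {}" by blast
    then have s: "d \<subseteq> gap b c" using cl by blast
    then have "d \<subseteq> {Min b..Max c}" using o unfolding gap_def by fastforce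
    then have "d = b \<or> d = c" using lf d by blast
    moreover have "Min d \<in> gap b c" "Max d \<in> gap b c"
      using s block_Min_in[OF Y d(1)] block_Max_in[OF Y d(1)] by auto
    ultimately show False unfolding gap_def by auto
  qed
  ultimately show ?R using lt unfolding leaf_pairs_def touching_def by auto
next
  assume R: ?R
  then have lv: "b \<in> leaves Y" "c \<in> leaves Y" and lt: "Max b < Min c" and g: "\<Union>Y \<inter> gap b c = {}"
    unfolding leaf_pairs_def touching_def by auto
  have b: "b \<in> Y" and c: "c \<in> Y" using lv leaf_in by auto
  have sib: "(b, c) \<in> sibling_pairs Y" using b c lt g unfolding sibling_pairs_def by blast
  have "\<not> d \<subseteq> {Min b..Max c}" if d: "d \<in> Y" "d \<noteq> b" "d \<noteq> c" for d
  proof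
    assume s: "d \<subseteq> {Min b..Max c}"
    have z: "Min d \<in> d" using block_Min_in[OF Y d(1)] .
    then have "Min b \<le> Min d" "Min d \<le> Max c" using s by auto
    moreover have "Min d \<notin> gap b c" using g z d by blast
    ultimately have "(Min b \<le> Min d \<and> Min d \<le> Max b) \<or> (Min c \<le> Min d \<and> Min d \<le> Max c)"
      unfolding gap_def by auto
    then have "nest_le b d \<or> nest_le c d"
      using nest_le_of_mem_range[OF Y b d(1) z] nest_le_of_mem_range[OF Y c d(1) z] by auto
    then show False using lv d unfolding leaves_def by auto
  qed
  then have "b \<union> c \<in> leaves (merge_pair Y (b, c))"
    using merged_nest_le_iff_sibling[OF b c lt] unfolding leaves_def merge_pair_def by auto
  then show ?L using sib by blast
qed

text \<open>The merged block spans exactly the outer block, whose only inner block must be \<open>c\<close>.\<close>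
lemma merged_nested_leaf_iff:
  "(b, c) \<in> nested_pairs Y \<and> b \<union> c \<in> leaves (merge_pair Y (b, c)) \<longleftrightarrow> (b, c) \<in> twig_pairs Y" (is "?L \<longleftrightarrow> ?R")
proof
  assume L: ?L
  then have b: "b \<in> Y" and c: "c \<in> Y" and bc: "b \<noteq> c" "nest_le b c"
    unfolding nested_pairs_def by auto
  have lf: "d = b \<or> d = c" if d: "d \<in> Y" "nest_le b d" for d
    using L d merged_notin[OF b c bc(1)] merged_nest_le_iff_nested[OF b c bc(2), of d]
    unfolding leaves_def merge_pair_def by auto
  have "c \<in> leaves Y"
  proof -
    have "d = c" if d: "d \<in> Y" "nest_le c d" for d
    proof -
      have "nest_le b d"
        using bc(2) d block_nest_le_iff[OF Y b c] block_nest_le_iff[OF Y b d(1)] block_nest_le_iff[OF Y c d(1)] by auto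
      moreover have "d \<noteq> b" using nest_le_antisym[OF Y b c] bc d by blast
      ultimately show ?thesis using lf d by blast
    qed
    then show ?thesis using c unfolding leaves_def by blast
  qed
  moreover have "b \<in> leaves (Y - {c})" using lf b bc unfolding leaves_def by auto
  moreover have "b \<notin> leaves Y" using bc c unfolding leaves_def by auto
  ultimately show ?R unfolding twig_pairs_def by auto
next
  assume R: ?R
  then have lc: "c \<in> leaves Y" and lb: "b \<in> leaves (Y - {c})" and nb: "b \<notin> leaves Y"
    unfolding twig_pairs_def by auto
  have b: "b \<in> Y" "b \<noteq> c" and c: "c \<in> Y" using lc lb unfolding leaves_def by auto
  have lb': "d = b \<or> d = c" if "d \<in> Y" "nest_le b d" for d using lb that unfolding leaves_def by auto
  have bc: "nest_le b c"
    using nb b lb' unfolding leaves_def by auto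
  have "(b, c) \<in> nested_pairs Y" using b c bc lb' unfolding nested_pairs_def by auto
  moreover have "b \<union> c \<in> leaves (merge_pair Y (b, c))"
    using lb' merged_nest_le_iff_nested[OF b(1) c bc] unfolding leaves_def merge_pair_def by auto
  ultimately show ?L by blast
qed

end

section \<open>The recursion for the sum over pairs\<close>

definition pair_sum :: "nat set set \<Rightarrow> 'k::field_char_0" where
  "pair_sum Y = (\<Sum>p\<in>sibling_pairs Y. of_nat (num_lin_ext (merge_pair Y p))) +
     1 / 2 * (\<Sum>p\<in>nested_pairs Y. of_nat (num_lin_ext (merge_pair Y p)))"

context
  fixes Y :: "nat set set"
  assumes Y: "nc_family Y"
begin

lemma finite_leaves: "finite (leaves Y)"
  using family_finite[OF Y] unfolding leaves_def by auto

lemma finite_pairs: "finite (sibling_pairs Y)" "finite (nested_pairs Y)" "finite (leaf_pairs Y)" "finite (twig_pairs Y)"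
proof -
  have "finite (Y \<times> Y)" using family_finite[OF Y] by auto
  moreover have "sibling_pairs Y \<subseteq> Y \<times> Y" "nested_pairs Y \<subseteq> Y \<times> Y" "leaf_pairs Y \<subseteq> Y \<times> Y" "twig_pairs Y \<subseteq> Y \<times> Y"
    unfolding sibling_pairs_def nested_pairs_def leaf_pairs_def twig_pairs_def leaves_def by auto
  ultimately show "finite (sibling_pairs Y)" "finite (nested_pairs Y)" "finite (leaf_pairs Y)" "finite (twig_pairs Y)"
    using finite_subset by blast+
qed

lemma sum_num_lin_ext_merge_rec:
  assumes S: "S \<subseteq> sibling_pairs Y \<union> nested_pairs Y"
  shows "(\<Sum>p\<in>S. num_lin_ext (merge_pair Y p)) =
    (\<Sum>l\<in>leaves Y. \<Sum>p\<in>{p \<in> S. fst p \<noteq> l \<and> snd p \<noteq> l}. num_lin_ext (merge_pair (Y - {l}) p)) +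
    (\<Sum>p\<in>{p \<in> S. fst p \<union> snd p \<in> leaves (merge_pair Y p)}. num_lin_ext (Y - {fst p, snd p}))"
proof -
  have fin: "finite S" using S finite_pairs by (meson finite_UnI finite_subset)
  have "(\<Sum>p\<in>S. num_lin_ext (merge_pair Y p)) =
     (\<Sum>p\<in>S. (\<Sum>l\<in>{l \<in> leaves Y. fst p \<noteq> l \<and> snd p \<noteq> l}. num_lin_ext (merge_pair (Y - {l}) p)) +
        (if fst p \<union> snd p \<in> leaves (merge_pair Y p) then num_lin_ext (Y - {fst p, snd p}) else 0))"
  proof (rule sum.cong[OF refl])
    fix p assume p: "p \<in> S"
    have "{l \<in> leaves Y. fst p \<noteq> l \<and> snd p \<noteq> l} = leaves Y - {fst p, snd p}" by auto
    moreover have "(fst p, snd p) \<in> sibling_pairs Y \<union> nested_pairs Y" using p S by auto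
    ultimately show "num_lin_ext (merge_pair Y p) = 
       (\<Sum>l\<in>{l \<in> leaves Y. fst p \<noteq> l \<and> snd p \<noteq> l}. num_lin_ext (merge_pair (Y - {l}) p)) +
        (if fst p \<union> snd p \<in> leaves (merge_pair Y p) then num_lin_ext (Y - {fst p, snd p}) else 0)"
      using num_lin_ext_merge_rec[OF Y, of "fst p" "snd p"] by simp
  qed
  also have "\<dots> = (\<Sum>p\<in>S. \<Sum>l\<in>{l \<in> leaves Y. fst p \<noteq> l \<and> snd p \<noteq> l}. num_lin_ext (merge_pair (Y - {l}) p)) +
     (\<Sum>p\<in>{p \<in> S. fst p \<union> snd p \<in> leaves (merge_pair Y p)}. num_lin_ext (Y - {fst p, snd p}))"
    unfolding sum.distrib sum.inter_filter[OF fin] by simp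
  also have "(\<Sum>p\<in>S. \<Sum>l\<in>{l \<in> leaves Y. fst p \<noteq> l \<and> snd p \<noteq> l}. num_lin_ext (merge_pair (Y - {l}) p)) =
     (\<Sum>l\<in>leaves Y. \<Sum>p\<in>{p \<in> S. fst p \<noteq> l \<and> snd p \<noteq> l}. num_lin_ext (merge_pair (Y - {l}) p))"
    by (rule sum.swap_restrict[OF fin finite_leaves])
  finally show ?thesis .
qed

text \<open>The last two blocks of a linear extension are two leaves, in one of two orders, or a leaf
on top of the block that becomes a leaf by its removal.\<close>
lemma num_lin_ext_rec2:
  assumes card: "card Y \<ge> 2"
  shows "num_lin_ext Y = 2 * (\<Sum>p\<in>leaf_pairs Y. num_lin_ext (Y - {fst p, snd p})) +
    (\<Sum>p\<in>twig_pairs Y. num_lin_ext (Y - {fst p, snd p}))"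
proof -
  let ?g = "\<lambda>p. num_lin_ext (Y - {fst p, snd p})"
  have fin: "finite Y" using family_finite[OF Y] .
  have irr: "\<not> Max l < Min l" if "l \<in> Y" for l
    using block_Min_le_Max[OF Y that] by simp
  have asym: "\<not> (Max l < Min m \<and> Max m < Min l)" if "l \<in> leaves Y" "m \<in> leaves Y" for l m
    using irr[OF leaf_in[OF Y that(1)]] irr[OF leaf_in[OF Y that(2)]] by linarith
  have "Y \<noteq> {}" using card by auto
  then have "num_lin_ext Y = (\<Sum>l\<in>leaves Y. num_lin_ext (Y - {l}))"
    by (rule num_lin_ext_rec[OF fin])
  also have "\<dots> = (\<Sum>l\<in>leaves Y. \<Sum>l'\<in>leaves (Y - {l}). num_lin_ext (Y - {l, l'}))"
  proof (rule sum.cong[OF refl])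
    fix l assume "l \<in> leaves Y"
    then have "card (Y - {l}) = card Y - 1" using fin leaf_in[OF Y] by simp
    then have "Y - {l} \<noteq> {}" using card by force
    then show "num_lin_ext (Y - {l}) = (\<Sum>l'\<in>leaves (Y - {l}). num_lin_ext (Y - {l, l'}))"
      using num_lin_ext_rec[of "Y - {l}"] fin by (simp add: Diff_insert2[of Y, symmetric] insert_commute)
  qed
  also have "\<dots> = (\<Sum>p\<in>Sigma (leaves Y) (\<lambda>l. leaves (Y - {l})). ?g p)"
    by (subst sum.Sigma) (use fin in \<open>auto simp: leaves_def split_beta\<close>)
  also have "Sigma (leaves Y) (\<lambda>l. leaves (Y - {l})) =
      leaf_pairs Y \<union> ((leaf_pairs Y)\<inverse> \<union> (twig_pairs Y)\<inverse>)" (is "?S = ?T")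
  proof
    show "?S \<subseteq> ?T"
    proof
      fix p assume "p \<in> ?S"
      then obtain l m where p: "p = (l, m)" "l \<in> leaves Y" "m \<in> leaves (Y - {l})" by auto
      have m: "m \<in> Y" "m \<noteq> l" and l: "l \<in> Y" using p unfolding leaves_def by auto
      show "p \<in> ?T"
      proof (cases "m \<in> leaves Y")
        case True
        then have "\<not> nest_le l m" "\<not> nest_le m l" using p m l unfolding leaves_def by auto
        then have "Max l < Min m \<or> Max m < Min l" using block_trichotomy[OF Y l m(1)] by auto
        then show ?thesis using p True unfolding leaf_pairs_def by auto
      next
        case False
        then show ?thesis using p unfolding twig_pairs_def by auto
      qed
    qed
    show "?T \<subseteq> ?S"
      using irr unfolding leaf_pairs_def twig_pairs_def leaves_def by auto
  qed
  also have "(\<Sum>p\<in>?T. ?g p) = (\<Sum>p\<in>leaf_pairs Y. ?g p) + ((\<Sum>p\<in>(leaf_pairs Y)\<inverse>. ?g p) + (\<Sum>p\<in>(twig_pairs Y)\<inverse>. ?g p))"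
  proof -
    have "leaf_pairs Y \<inter> ((leaf_pairs Y)\<inverse> \<union> (twig_pairs Y)\<inverse>) = {}" "(leaf_pairs Y)\<inverse> \<inter> (twig_pairs Y)\<inverse> = {}"
      using asym unfolding leaf_pairs_def twig_pairs_def by auto
    then show ?thesis using finite_pairs by (simp add: sum.union_disjoint)
  qed
  also have "(\<lambda>S. \<Sum>p\<in>S\<inverse>. ?g p) = (\<lambda>S. \<Sum>p\<in>S. ?g p)"
    by (intro ext sum.reindex_bij_witness[of _ prod.swap prod.swap]) (auto simp: insert_commute)
  finally show ?thesis by simp
qed

text \<open>Removing the top block of a merge gives the sum over leaves and the terms of touching
leaf pairs and of twigs. By \<open>num_lin_ext_rec2\<close> these extra terms are half of the linear
extensions of \<open>Y\<close>, up to the leaf pairs that do not touch.\<close>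
lemma pair_sum_rec:
  assumes card: "card Y \<ge> 2"
  shows "(pair_sum Y :: 'k::field_char_0) = (\<Sum>l\<in>leaves Y. pair_sum (Y - {l})) + of_nat (num_lin_ext Y) / 2
    - (\<Sum>p\<in>{p \<in> leaf_pairs Y. \<not> touching Y p}. of_nat (num_lin_ext (Y - {fst p, snd p})))"
proof -
  let ?g = "\<lambda>p. num_lin_ext (Y - {fst p, snd p})"
  define s n where "s Z = (\<Sum>p\<in>sibling_pairs Z. num_lin_ext (merge_pair Z p))"
    and "n Z = (\<Sum>p\<in>nested_pairs Z. num_lin_ext (merge_pair Z p))" for Z
  have ps: "pair_sum Z = (of_nat (s Z) + of_nat (n Z) / 2 :: 'k)" for Z
    unfolding pair_sum_def s_def n_def by simp
  define T U W where "T = (\<Sum>p\<in>{p \<in> leaf_pairs Y. touching Y p}. ?g p)"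
    and "U = (\<Sum>p\<in>{p \<in> leaf_pairs Y. \<not> touching Y p}. ?g p)"
    and "W = (\<Sum>p\<in>twig_pairs Y. ?g p)"
  have s: "s Y = (\<Sum>l\<in>leaves Y. s (Y - {l})) + T"
  proof -
    have "{p \<in> sibling_pairs Y. fst p \<union> snd p \<in> leaves (merge_pair Y p)} = {p \<in> leaf_pairs Y. touching Y p}"
      using merged_sibling_leaf_iff[OF Y, of "fst p" "snd p" for p] by (intro set_eqI) simp
    moreover have "{p \<in> sibling_pairs Y. fst p \<noteq> l \<and> snd p \<noteq> l} = sibling_pairs (Y - {l})" if "l \<in> leaves Y" for l
      unfolding sibling_pairs_remove_leaf[OF Y that] by auto
    ultimately show ?thesis
      unfolding s_def T_def by (subst sum_num_lin_ext_merge_rec) auto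
  qed
  have n: "n Y = (\<Sum>l\<in>leaves Y. n (Y - {l})) + W"
  proof -
    have "{p \<in> nested_pairs Y. fst p \<union> snd p \<in> leaves (merge_pair Y p)} = twig_pairs Y"
      using merged_nested_leaf_iff[OF Y, of "fst p" "snd p" for p] by (intro set_eqI) simp
    moreover have "{p \<in> nested_pairs Y. fst p \<noteq> l \<and> snd p \<noteq> l} = nested_pairs (Y - {l})" if "l \<in> leaves Y" for l
      unfolding nested_pairs_remove_leaf[OF Y that] by auto
    ultimately show ?thesis
      unfolding n_def W_def by (subst sum_num_lin_ext_merge_rec) auto
  qed
  have "(\<Sum>p\<in>leaf_pairs Y. ?g p) = T + U"
  proof -
    have "leaf_pairs Y = {p \<in> leaf_pairs Y. touching Y p} \<union> {p \<in> leaf_pairs Y. \<not> touching Y p}" by auto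
    then show ?thesis
      unfolding T_def U_def using finite_pairs(3)
      by (metis (no_types, lifting) Collect_mem_eq sum.union_disjoint disjoint_iff finite_Un mem_Collect_eq)
  qed
  then have "num_lin_ext Y = 2 * (T + U) + W"
    using num_lin_ext_rec2[OF card] unfolding W_def by simp
  then have e: "(of_nat (num_lin_ext Y) :: 'k) = 2 * (of_nat T + of_nat U) + of_nat W" by simp
  have U: "(\<Sum>p\<in>{p \<in> leaf_pairs Y. \<not> touching Y p}. of_nat (?g p)) = (of_nat U :: 'k)"
    unfolding U_def by simp
  show ?thesis
    unfolding U ps e unfolding s n by (simp add: sum.distrib add_divide_distrib flip: sum_divide_distrib)
qed

end

section \<open>Invariance under increasing relabellings\<close>

lemma num_lin_ext_iso:
  assumes "finite Y" "inj_on h Y" "\<And>b c. b \<in> Y \<Longrightarrow> c \<in> Y \<Longrightarrow> nest_le (h b) (h c) \<longleftrightarrow> nest_le b c"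
  shows "num_lin_ext (h ` Y) = num_lin_ext Y"
  using assms
proof (induction "card Y" arbitrary: Y)
  case 0
  then show ?case by simp
next
  case (Suc n)
  note inj = Suc.prems(2) and iso = Suc.prems(3)
  have ne: "Y \<noteq> {}" using Suc.hyps by auto
  have lsub: "leaves Y \<subseteq> Y" unfolding leaves_def by auto
  have lv: "leaves (h ` Y) = h ` leaves Y"
  proof -
    have "h l \<in> leaves (h ` Y) \<longleftrightarrow> l \<in> leaves Y" if "l \<in> Y" for l
      using that iso inj_on_eq_iff[OF inj] unfolding leaves_def by simp
    moreover have "leaves (h ` Y) \<subseteq> h ` Y" unfolding leaves_def by auto
    ultimately show ?thesis using lsub by (auto 0 4)
  qed
  have "num_lin_ext (h ` Y) = (\<Sum>l\<in>leaves (h ` Y). num_lin_ext (h ` Y - {l}))"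
    by (rule num_lin_ext_rec) (use Suc.prems ne in auto)
  also have "\<dots> = (\<Sum>l\<in>leaves Y. num_lin_ext (h ` Y - {h l}))"
    unfolding lv by (rule sum.reindex_cong[OF inj_on_subset[OF inj lsub]]) auto
  also have "\<dots> = (\<Sum>l\<in>leaves Y. num_lin_ext (Y - {l}))"
  proof (rule sum.cong[OF refl])
    fix l assume "l \<in> leaves Y"
    then have l: "l \<in> Y" using lsub by auto
    have "h ` Y - {h l} = h ` (Y - {l})" using inj_on_image_set_diff[OF inj, of Y "{l}"] l by simp
    moreover have "num_lin_ext (h ` (Y - {l})) = num_lin_ext (Y - {l})"
      by (rule Suc.hyps(1)) (use Suc.hyps(2) Suc.prems l inj in \<open>auto intro: inj_on_subset\<close>)
    ultimately show "num_lin_ext (h ` Y - {h l}) = num_lin_ext (Y - {l})" by simp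
  qed
  also have "\<dots> = num_lin_ext Y" by (rule num_lin_ext_rec[symmetric, OF Suc.prems(1) ne])
  finally show ?case .
qed

context
  fixes S :: "nat set" and g :: "nat \<Rightarrow> nat"
  assumes g: "strict_mono_on S g"
begin

lemma Min_relabel: "finite b \<Longrightarrow> b \<noteq> {} \<Longrightarrow> b \<subseteq> S \<Longrightarrow> Min (g ` b) = g (Min b)"
  by (intro Min_eqI) (auto intro!: strict_mono_on_leD[OF g] Min_le Min_in dest: subsetD)

lemma Max_relabel: "finite b \<Longrightarrow> b \<noteq> {} \<Longrightarrow> b \<subseteq> S \<Longrightarrow> Max (g ` b) = g (Max b)"
  by (intro Max_eqI) (auto intro!: strict_mono_on_leD[OF g] Max_ge Max_in dest: subsetD)

lemma relabel_less_iff: "x \<in> S \<Longrightarrow> y \<in> S \<Longrightarrow> g x < g y \<longleftrightarrow> x < y"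
  by (metis g linorder_neq_iff order_less_asym strict_mono_on_def)

lemma relabel_le_iff: "x \<in> S \<Longrightarrow> y \<in> S \<Longrightarrow> g x \<le> g y \<longleftrightarrow> x \<le> y"
  using relabel_less_iff by (metis linorder_not_less)

lemma relabel_inj: "inj_on g S"
  by (rule strict_mono_on_imp_inj_on[OF g])

lemma nest_le_relabel:
  assumes "finite b" "b \<noteq> {}" "b \<subseteq> S" "finite c" "c \<noteq> {}" "c \<subseteq> S"
  shows "nest_le (g ` b) (g ` c) \<longleftrightarrow> nest_le b c"
proof -
  have "Min b \<in> S" "Max b \<in> S" "Min c \<in> S" "Max c \<in> S" using assms by (meson Min_in Max_in subsetD)+
  then show ?thesis
    using assms by (simp add: nest_le_iff Min_relabel Max_relabel relabel_le_iff)
qed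

text \<open>Relabelling preserves the minima and maxima of blocks, hence the nesting order.\<close>
lemma num_lin_ext_relabel:
  assumes "finite Y" "\<And>b. b \<in> Y \<Longrightarrow> finite b \<and> b \<noteq> {} \<and> b \<subseteq> S"
  shows "num_lin_ext ((`) g ` Y) = num_lin_ext Y"
proof (rule num_lin_ext_iso[OF assms(1)])
  show "inj_on ((`) g) Y"
    by (rule inj_on_subset[OF inj_on_image_Pow[OF relabel_inj]]) (use assms(2) in auto)
qed (use assms(2) in \<open>simp add: nest_le_relabel\<close>)

lemma pair_sum_relabel:
  assumes Y: "nc_family Y" and sub: "\<Union>Y \<subseteq> S"
  shows "(pair_sum ((`) g ` Y) :: 'k::field_char_0) = pair_sum Y"
proof -
  let ?h = "(`) g" and ?k = "\<lambda>p. (g ` fst p, g ` snd p)"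
  have blk: "finite b \<and> b \<noteq> {} \<and> b \<subseteq> S" if "b \<in> Y" for b
    using that block_finite[OF Y] block_nonempty[OF Y] sub by auto
  have MS: "Min b \<in> S" "Max b \<in> S" if "b \<in> Y" for b
    using blk that block_Min_in[OF Y] block_Max_in[OF Y] by blast+
  have injh: "inj_on ?h (Pow S)" by (rule inj_on_image_Pow[OF relabel_inj])
  have eqh: "g ` b = g ` c \<longleftrightarrow> b = c" if "b \<in> Y" "c \<in> Y" for b c
    using inj_onD[OF injh, of b c] blk that by auto
  have injk: "inj_on ?k (Y \<times> Y)" using eqh by (auto simp: inj_on_def)
  have sub_pairs: "sibling_pairs Z \<subseteq> Z \<times> Z" "nested_pairs Z \<subseteq> Z \<times> Z" for Z
    unfolding sibling_pairs_def nested_pairs_def by auto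
  have meet: "g ` d \<inter> gap (g ` b) (g ` c) \<noteq> {} \<longleftrightarrow> d \<inter> gap b c \<noteq> {}"
       "g ` d \<subseteq> gap (g ` b) (g ` c) \<longleftrightarrow> d \<subseteq> gap b c"
    if bc: "b \<in> Y" "c \<in> Y" "d \<in> Y" for b c d
  proof -
    have "g z \<in> gap (g ` b) (g ` c) \<longleftrightarrow> z \<in> gap b c" if z: "z \<in> d" for z
    proof -
      have "z \<in> S" using z bc blk by auto
      then show ?thesis
        using bc blk MS unfolding gap_def by (simp add: Min_relabel Max_relabel relabel_less_iff)
    qed
    then show "g ` d \<inter> gap (g ` b) (g ` c) \<noteq> {} \<longleftrightarrow> d \<inter> gap b c \<noteq> {}"
       "g ` d \<subseteq> gap (g ` b) (g ` c) \<longleftrightarrow> d \<subseteq> gap b c" by auto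
  qed
  have sib: "(g ` b, g ` c) \<in> sibling_pairs (?h ` Y) \<longleftrightarrow> (b, c) \<in> sibling_pairs Y" if "b \<in> Y" "c \<in> Y" for b c
    using that blk MS meet[OF that] unfolding sibling_pairs_def
    by (simp add: Min_relabel Max_relabel relabel_less_iff del: Max_less_iff Min_gr_iff)
  have nst: "(g ` b, g ` c) \<in> nested_pairs (?h ` Y) \<longleftrightarrow> (b, c) \<in> nested_pairs Y" if "b \<in> Y" "c \<in> Y" for b c
    using that blk eqh unfolding nested_pairs_def by (simp add: nest_le_relabel)
  have img: "A = ?k ` B" if AB: "A \<subseteq> ?h ` Y \<times> ?h ` Y" "B \<subseteq> Y \<times> Y"
      "\<And>b c. b \<in> Y \<Longrightarrow> c \<in> Y \<Longrightarrow> (g ` b, g ` c) \<in> A \<longleftrightarrow> (b, c) \<in> B" for A B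
  proof
    show "A \<subseteq> ?k ` B"
    proof
      fix p assume p: "p \<in> A"
      then obtain b c where "p = (g ` b, g ` c)" "b \<in> Y" "c \<in> Y" using AB(1) by auto
      then show "p \<in> ?k ` B" using AB(3) p by force
    qed
    show "?k ` B \<subseteq> A" using AB(2,3) by auto
  qed
  have s: "sibling_pairs (?h ` Y) = ?k ` sibling_pairs Y"
    by (rule img) (use sub_pairs sib in auto)
  have n: "nested_pairs (?h ` Y) = ?k ` nested_pairs Y"
    by (rule img) (use sub_pairs nst in auto)
  have mrg: "num_lin_ext (merge_pair (?h ` Y) (?k p)) = num_lin_ext (merge_pair Y p)" if p: "p \<in> Y \<times> Y" for p
  proof -
    obtain b c where bc: "p = (b, c)" "b \<in> Y" "c \<in> Y" using p by auto
    have "?h ` Y - {g ` b, g ` c} = ?h ` (Y - {b, c})"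
      using eqh bc by auto
    then have "merge_pair (?h ` Y) (?k p) = ?h ` merge_pair Y p"
      unfolding merge_pair_def bc by (simp add: image_Un)
    moreover have "num_lin_ext (?h ` merge_pair Y p) = num_lin_ext (merge_pair Y p)"
      by (rule num_lin_ext_relabel) (use blk bc family_finite[OF Y] in \<open>auto simp: merge_pair_def\<close>)
    ultimately show ?thesis by simp
  qed
  have "(\<Sum>p\<in>?k ` B. of_nat (num_lin_ext (merge_pair (?h ` Y) p))) =
        (\<Sum>p\<in>B. of_nat (num_lin_ext (merge_pair Y p)) :: 'k)" if "B \<subseteq> Y \<times> Y" for B
    by (subst sum.reindex[OF inj_on_subset[OF injk that]]) (use that mrg in \<open>auto intro!: sum.cong\<close>)
  then show ?thesis
    unfolding pair_sum_def s n using sub_pairs by simp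
qed

end

section \<open>Close pairs in a noncrossing partition\<close>

lemma nc_family_of_is_ncp:
  assumes "is_ncp P"
  shows "nc_family P"
proof -
  obtain n where n: "partition_on {1..n} P" "noncrossing P" using assms unfolding is_ncp_def by auto
  have "finite P" using finite_elements[OF _ n(1)] by simp
  moreover have "finite b" if "b \<in> P" for b
    using that n(1) unfolding partition_on_def by (metis Union_upper finite_atLeastAtMost finite_subset)
  ultimately show ?thesis using n unfolding nc_family_def partition_on_def by auto
qed

text \<open>A block meeting the gap between \<open>a\<close> and \<open>c\<close> meets one of the two smaller gaps or the range of
\<open>b\<close>, and stays inside whichever it meets.\<close>
lemma sibling_pairs_trans:
  assumes Y: "nc_family Y" and ab: "(a, b) \<in> sibling_pairs Y" and bc: "(b, c) \<in> sibling_pairs Y"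
  shows "(a, c) \<in> sibling_pairs Y"
proof -
  have abc: "a \<in> Y" "b \<in> Y" "c \<in> Y" and lt: "Max a < Min b" "Max b < Min c"
    and cl: "\<And>d. d \<in> Y \<Longrightarrow> d \<inter> gap a b \<noteq> {} \<Longrightarrow> d \<subseteq> gap a b" "\<And>d. d \<in> Y \<Longrightarrow> d \<inter> gap b c \<noteq> {} \<Longrightarrow> d \<subseteq> gap b c"
    using ab bc unfolding sibling_pairs_def by auto
  have le: "Min b \<le> Max b" using block_Min_le_Max[OF Y abc(2)] .
  have "d \<subseteq> gap a c" if d: "d \<in> Y" "d \<inter> gap a c \<noteq> {}" for d
  proof -
    obtain z where z: "z \<in> d" "Max a < z" "z < Min c" using d unfolding gap_def by auto
    consider "z < Min b" | "Min b \<le> z" "z \<le> Max b" | "Max b < z" by linarith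
    then show ?thesis
    proof cases
      case 1
      then have "z \<in> gap a b" using z unfolding gap_def by simp
      then have "d \<subseteq> gap a b" using cl(1)[OF d(1)] z(1) by blast
      then show ?thesis using lt le unfolding gap_def by fastforce
    next
      case 2
      then have "d \<subseteq> {Min b..Max b}"
        using nest_le_of_mem_range[OF Y abc(2) d(1) z(1)] unfolding nest_le_def by simp
      then show ?thesis using lt unfolding gap_def by fastforce
    next
      case 3
      then have "z \<in> gap b c" using z unfolding gap_def by simp
      then have "d \<subseteq> gap b c" using cl(2)[OF d(1)] z(1) by blast
      then show ?thesis using lt le unfolding gap_def by fastforce
    qed
  qed
  then show ?thesis using abc lt le unfolding sibling_pairs_def by auto
qed

text \<open>Consecutive blocks of a chain have an empty gap, and transitivity does the rest. Conversely the
blocks in the gap fill it without holes, so the one starting right after \<open>b\<close> continues the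
chain.\<close>
lemma close_pairs_eq_sibling_pairs:
  assumes P: "is_ncp P"
  shows "close_pairs P = sibling_pairs P"
proof -
  obtain n where n: "\<Union>P = {1..n}" using P unfolding is_ncp_def partition_on_def by auto
  have Y: "nc_family P" using nc_family_of_is_ncp[OF P] .
  let ?adj = "\<lambda>c c'. Max c + 1 = Min c'"
  have adj: "(b, c) \<in> sibling_pairs P" if "b \<in> P" "c \<in> P" "?adj b c" for b c
    using that unfolding sibling_pairs_def gap_def by auto
  have chain: "hd bs = last bs \<or> (hd bs, last bs) \<in> sibling_pairs P"
    if "bs \<noteq> []" "set bs \<subseteq> P" "successively ?adj bs" for bs
    using that
  proof (induction bs rule: list_nonempty_induct)
    case (single x)
    then show ?case by simp
  next
    case (cons x xs)
    have "(x, hd xs) \<in> sibling_pairs P"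
      by (rule adj) (use cons in \<open>auto simp: successively_Cons\<close>)
    moreover have "hd xs = last xs \<or> (hd xs, last xs) \<in> sibling_pairs P"
      by (rule cons.IH) (use cons.prems cons.hyps in \<open>auto simp: successively_Cons\<close>)
    ultimately show ?case using sibling_pairs_trans[OF Y] cons.hyps by auto
  qed
  have conv: "\<exists>bs. bs \<noteq> [] \<and> set bs \<subseteq> P \<and> hd bs = b \<and> last bs = c \<and> successively ?adj bs"
    if "(b, c) \<in> sibling_pairs P" for b c
    using that
  proof (induction "Min c - Max b" arbitrary: b rule: less_induct)
    case less
    have b: "b \<in> P" and c: "c \<in> P" and lt: "Max b < Min c"
      and cl: "\<And>d. d \<in> P \<Longrightarrow> d \<inter> gap b c \<noteq> {} \<Longrightarrow> d \<subseteq> gap b c"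
      using less.prems unfolding sibling_pairs_def by auto
    show ?case
    proof (cases "?adj b c")
      case True
      then show ?thesis using b c by (intro exI[of _ "[b, c]"]) auto
    next
      case False
      then have "Max b + 1 \<in> gap b c" using lt unfolding gap_def by auto
      moreover have "Min c \<le> n" using block_Min_in[OF Y c] c n by auto
      ultimately have "Max b + 1 \<in> \<Union>P" unfolding n gap_def by auto
      then obtain d where d: "d \<in> P" "Max b + 1 \<in> d" by auto
      have dg: "d \<subseteq> gap b c" by (rule cl[OF d(1)]) (use d(2) \<open>Max b + 1 \<in> gap b c\<close> in blast)
      have "Min d \<in> gap b c" "Max d \<in> gap b c" using dg block_Min_in[OF Y d(1)] block_Max_in[OF Y d(1)] by auto
      moreover have "Min d \<le> Max b + 1" "Max b + 1 \<le> Max d" using block_Min_le[OF Y d] block_Max_ge[OF Y d] .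
      ultimately have mM: "Min d = Max b + 1" "Max d < Min c" "Max b < Max d" unfolding gap_def by auto
      have "(d, c) \<in> sibling_pairs P"
      proof -
        have "e \<subseteq> gap d c" if e: "e \<in> P" "e \<inter> gap d c \<noteq> {}" for e
        proof -
          obtain z where z: "z \<in> e" "Max d < z" "z < Min c" using e unfolding gap_def by auto
          then have "z \<in> gap b c" using mM unfolding gap_def by simp
          then have eg: "e \<subseteq> gap b c" using cl[OF e(1)] z(1) by blast
          have "x \<in> gap d c" if x: "x \<in> e" for x
          proof -
            have xg: "Max b < x" "x < Min c" using eg x unfolding gap_def by auto
            have "\<not> x \<le> Max d"
            proof
              assume "x \<le> Max d"
              then have "nest_le d e" using nest_le_of_mem_range[OF Y d(1) e(1) x] xg mM by simp
              then show False using z unfolding nest_le_def by auto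
            qed
            then show ?thesis using xg unfolding gap_def by auto
          qed
          then show ?thesis by auto
        qed
        then show ?thesis using d(1) c mM unfolding sibling_pairs_def by auto
      qed
      moreover have "Min c - Max d < Min c - Max b" using mM lt by auto
      ultimately obtain bs where bs: "bs \<noteq> []" "set bs \<subseteq> P" "hd bs = d" "last bs = c" "successively ?adj bs"
        using less.hyps by blast
      then show ?thesis
        using b mM by (intro exI[of _ "b # bs"]) (auto simp: successively_Cons)
    qed
  qed
  have "(b, c) \<in> close_pairs P \<longleftrightarrow> (b, c) \<in> sibling_pairs P" for b c
  proof
    assume "(b, c) \<in> close_pairs P"
    then obtain bs where b: "b \<in> P" "c \<in> P" and lt: "b \<noteq> c" "Max b < Min c" and bs: "bs \<noteq> []" "set bs \<subseteq> P" "successively ?adj bs"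
      and e: "hd bs = b \<and> last bs = c \<or> hd bs = c \<and> last bs = b"
      unfolding close_pairs_def chained_def by blast
    \<comment> \<open>Excludes a chain running from the right block to the left one.\<close>
    have "(c, b) \<notin> sibling_pairs P"
    proof
      assume "(c, b) \<in> sibling_pairs P"
      then have "Max c < Min b" unfolding sibling_pairs_def by auto
      then show False using lt block_Min_le_Max[OF Y b(1)] block_Min_le_Max[OF Y b(2)] by linarith
    qed
    then show "(b, c) \<in> sibling_pairs P" using chain[OF bs] e lt by auto
  next
    assume s: "(b, c) \<in> sibling_pairs P"
    have "b \<in> P" "c \<in> P" "Max b < Min c" using s unfolding sibling_pairs_def by auto
    moreover have "b \<noteq> c" using sibling_pairs_distinct[OF Y s] .
    moreover have "chained P b c" using conv[OF s] unfolding chained_def by blast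
    ultimately show "(b, c) \<in> close_pairs P" unfolding close_pairs_def by auto
  qed
  then show ?thesis by auto
qed

section \<open>Polynomials and the shift by one\<close>

lemma coeff_shift:
  assumes "degree p \<le> n"
  shows "coeff (pcompose p [:1, 1:]) k = (\<Sum>i\<le>n. coeff p i * of_nat (i choose k) :: 'k::comm_ring_1)"
proof -
  have "coeff ([:1, 1:] ^ i) k = (of_nat (i choose k) :: 'k)" for i
  proof (cases "k \<le> i")
    case True
    then show ?thesis by (simp add: coeff_linear_poly_power)
  next
    case False
    have "degree ([:1, 1:] ^ i :: 'k poly) \<le> 1 * i" by (rule order_trans[OF degree_power_le]) simp
    then show ?thesis using False by (simp add: coeff_eq_0 binomial_eq_0)
  qed
  moreover have "pcompose (monom a i) q = smult a (q ^ i)" for a :: 'k and i and q :: "'k poly"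
    by (induction i) (simp_all add: monom_0 monom_Suc pcompose_pCons)
  moreover have "pcompose p [:1, 1:] = pcompose (\<Sum>i\<le>n. monom (coeff p i) i) [:1, 1:]"
    using poly_as_sum_of_monoms'[OF assms] by simp
  ultimately show ?thesis by (simp add: pcompose_sum coeff_sum)
qed

text \<open>In characteristic zero the difference operator lowers the degree of a nonconstant polynomial by exactly one.\<close>
lemma degree_le_of_shift_diff:
  fixes p :: "'k::field_char_0 poly"
  assumes "degree (pcompose p [:1, 1:] - p) < n"
  shows "degree p \<le> n"
proof (rule ccontr)
  assume "\<not> degree p \<le> n"
  then obtain d where d: "degree p = Suc d" "n \<le> d" by (metis Suc_le_D not_less_eq_eq)
  have "coeff (pcompose p [:1, 1:]) d = (\<Sum>i\<le>Suc d. coeff p i * of_nat (i choose d))"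
    by (rule coeff_shift) (simp add: d)
  also have "\<dots> = coeff p d + of_nat (Suc d) * coeff p (Suc d) + (\<Sum>i<d. coeff p i * of_nat (i choose d))"
    by (simp add: lessThan_Suc_atMost[symmetric] algebra_simps)
  also have "(\<Sum>i<d. coeff p i * of_nat (i choose d)) = (0 :: 'k)"
    by (rule sum.neutral) (simp add: binomial_eq_0)
  finally have "coeff (pcompose p [:1, 1:] - p) d = of_nat (Suc d) * lead_coeff p" using d by simp
  moreover have "coeff (pcompose p [:1, 1:] - p) d = 0" by (rule coeff_eq_0) (use assms d in simp)
  moreover have "p \<noteq> 0" using d by auto
  ultimately show False by (simp del: of_nat_Suc)
qed

lemma poly_subst_tensor: "poly (subst_tensor p t) q = pcompose p (poly t q)"
  unfolding subst_tensor_def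
  by (induction p) (simp_all add: map_poly_pCons pcompose_pCons)

lemma poly_tensor_at_1: "poly (poly_tensor p q) 1 = smult (poly q 1) p"
proof -
  have "poly (map_poly (\<lambda>c. [:c:]) q) 1 = [:poly q 1:]"
    unfolding pcompose_altdef[symmetric] one_pCons by (rule pcompose_pCons_0)
  then show ?thesis unfolding poly_tensor_def by simp
qed

text \<open>The coproduct of \<open>X\<close> becomes \<open>X + 1\<close> when the outer indeterminate, which stands for the second
tensor factor, is set to \<open>1\<close>.\<close>
lemma Delta_poly_at_1: "poly (Delta_poly p) 1 = pcompose p [:1, 1:]"
  unfolding Delta_poly_def poly_subst_tensor poly_add poly_tensor_at_1 by (simp add: one_pCons)

section \<open>Algebra morphisms and the shift formula\<close>

lemma sum_keys_add:
  fixes h :: "'a \<Rightarrow> 'k::comm_ring_1 poly"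
  shows "(\<Sum>k\<in>Poly_Mapping.keys (s + t). smult (Poly_Mapping.lookup (s + t) k) (h k)) =
    (\<Sum>k\<in>Poly_Mapping.keys s. smult (Poly_Mapping.lookup s k) (h k)) +
    (\<Sum>k\<in>Poly_Mapping.keys t. smult (Poly_Mapping.lookup t k) (h k))"
  by (rule setsum_keys_plus_distrib) (simp_all add: smult_add_left)

lemma sum_keys_sum:
  fixes h :: "'a \<Rightarrow> 'k::comm_ring_1 poly"
  shows "(\<Sum>k\<in>Poly_Mapping.keys (\<Sum>i\<in>I. t i). smult (Poly_Mapping.lookup (\<Sum>i\<in>I. t i) k) (h k)) =
    (\<Sum>i\<in>I. \<Sum>k\<in>Poly_Mapping.keys (t i). smult (Poly_Mapping.lookup (t i) k) (h k))"
  by (induction I rule: infinite_finite_induct) (simp_all add: sum_keys_add)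

lemma sum_keys_single:
  fixes h :: "'a \<Rightarrow> 'k::comm_ring_1 poly"
  shows "(\<Sum>k\<in>Poly_Mapping.keys (Poly_Mapping.single m c). smult (Poly_Mapping.lookup (Poly_Mapping.single m c) k) (h k)) =
     smult c (h m)"
  by simp

context
  fixes \<phi> :: "'k::field_char_0 ncp_alg \<Rightarrow> 'k poly"
  assumes hom: "algebra_morphism \<phi>"
begin

lemma hom_add: "\<phi> (x + y) = \<phi> x + \<phi> y" and hom_mult: "\<phi> (x * y) = \<phi> x * \<phi> y"
  and hom_one: "\<phi> 1 = 1" and hom_scale: "\<phi> (Poly_Mapping.single 0 c * x) = smult c (\<phi> x)"
  using hom unfolding algebra_morphism_def by auto

lemma hom_zero: "\<phi> 0 = 0"
  using hom_add[of 0 0] by simp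

lemma hom_sum: "\<phi> (\<Sum>i\<in>I. f i) = (\<Sum>i\<in>I. \<phi> (f i))"
  by (induction I rule: infinite_finite_induct) (simp_all add: hom_zero hom_add)

lemma hom_prod: "\<phi> (\<Prod>i\<in>I. f i) = (\<Prod>i\<in>I. \<phi> (f i))"
  by (induction I rule: infinite_finite_induct) (simp_all add: hom_one hom_mult)

lemma hom_expand:
  "\<phi> x = (\<Sum>m\<in>Poly_Mapping.keys x. smult (Poly_Mapping.lookup x m) (\<phi> (Poly_Mapping.single m 1)))"
proof -
  have s: "\<phi> (Poly_Mapping.single m c) = smult c (\<phi> (Poly_Mapping.single m 1))" for m c
    using hom_scale[of c "Poly_Mapping.single m 1"] by (simp add: mult_single)
  have "x = (\<Sum>m\<in>Poly_Mapping.keys x. Poly_Mapping.single m (Poly_Mapping.lookup x m))"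
    by (rule poly_mapping_eqI) (simp add: lookup_sum lookup_single when_def sum.delta not_in_keys_iff_lookup_eq_zero)
  then have "\<phi> x = (\<Sum>m\<in>Poly_Mapping.keys x. \<phi> (Poly_Mapping.single m (Poly_Mapping.lookup x m)))"
    by (metis hom_sum)
  also have "\<dots> = (\<Sum>m\<in>Poly_Mapping.keys x. smult (Poly_Mapping.lookup x m) (\<phi> (Poly_Mapping.single m 1)))"
    by (rule sum.cong[OF refl s])
  finally show ?thesis .
qed

text \<open>Evaluated at \<open>1\<close>, the map \<open>\<phi> \<otimes> \<phi>\<close> is linear in the tensor and can be computed separately on each
summand of a coproduct.\<close>
lemma tensor_map_at_1:
  "poly (tensor_map \<phi> t) 1 = (\<Sum>k\<in>Poly_Mapping.keys t. smult (Poly_Mapping.lookup t k)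
     (smult (poly (\<phi> (Poly_Mapping.single (snd k) 1)) 1) (\<phi> (Poly_Mapping.single (fst k) 1))))"
  unfolding tensor_map_def poly_sum
  by (rule sum.cong) (auto simp: poly_tensor_at_1 mult.commute)

lemma tensor_map_tensor_at_1: "poly (tensor_map \<phi> (tensor x y)) 1 = smult (poly (\<phi> y) 1) (\<phi> x)"
proof -
  let ?s = "\<lambda>m. \<phi> (Poly_Mapping.single m 1)"
  have "poly (tensor_map \<phi> (tensor x y)) 1 = (\<Sum>m\<in>Poly_Mapping.keys x. \<Sum>m'\<in>Poly_Mapping.keys y.
      smult (Poly_Mapping.lookup x m * Poly_Mapping.lookup y m') (smult (poly (?s m') 1) (?s m)))"
    unfolding tensor_map_at_1 tensor_def sum_keys_sum sum_keys_single by simp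
  also have "\<dots> = (\<Sum>m\<in>Poly_Mapping.keys x. \<Sum>m'\<in>Poly_Mapping.keys y.
      [:Poly_Mapping.lookup y m' * poly (?s m') 1:] * smult (Poly_Mapping.lookup x m) (?s m))"
    by (simp add: mult_ac)
  also have "\<dots> = (\<Sum>m'\<in>Poly_Mapping.keys y. [:Poly_Mapping.lookup y m' * poly (?s m') 1:]) *
      (\<Sum>m\<in>Poly_Mapping.keys x. smult (Poly_Mapping.lookup x m) (?s m))"
    by (subst sum.swap) (simp only: sum_product)
  also have "(\<Sum>m\<in>Poly_Mapping.keys x. smult (Poly_Mapping.lookup x m) (?s m)) = \<phi> x"
    by (rule hom_expand[symmetric])
  also have "(\<Sum>m'\<in>Poly_Mapping.keys y. [:Poly_Mapping.lookup y m' * poly (?s m') 1:]) = [:poly (\<phi> y) 1:]"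
  proof -
    have "(\<Sum>k\<in>A. [:f k:]) = [:\<Sum>k\<in>A. f k:]" for A and f :: "ncp multiset \<Rightarrow> 'k"
      by (induction A rule: infinite_finite_induct) simp_all
    then show ?thesis by (subst (2) hom_expand) (simp add: poly_sum)
  qed
  finally show ?thesis by simp
qed

lemma tensor_map_sum_at_1:
  "poly (tensor_map \<phi> (\<Sum>i\<in>I. t i)) 1 = (\<Sum>i\<in>I. poly (tensor_map \<phi> (t i)) 1)"
  unfolding tensor_map_at_1 sum_keys_sum ..

end

lemma algebra_morphism_of_double: "double_bialgebra_morphism \<phi> \<Longrightarrow> algebra_morphism \<phi>"
  unfolding double_bialgebra_morphism_def by auto

lemma alg_extend_gen: "s 1 = 1 \<Longrightarrow> alg_extend s f (gen \<pi>) = f \<pi>"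
  unfolding alg_extend_def gen_def by simp

text \<open>Compatibility with \<open>\<Delta>\<close>, with the second tensor factor evaluated at \<open>1\<close>.\<close>
lemma shift_phi_gen:
  assumes "double_bialgebra_morphism \<phi>"
  shows "pcompose (\<phi> (gen \<pi>)) [:1, 1:] =
    (\<Sum>J\<in>ideals (blocks \<pi>). smult (poly (\<phi> (restrict_dot_ideal (blocks \<pi>) J)) 1)
       (\<phi> (restrict_ncp (blocks \<pi> - J))))"
proof -
  have hom: "algebra_morphism \<phi>" and D: "Delta_poly (\<phi> x) = tensor_map \<phi> (Delta_ncp x)" for x
    using assms unfolding double_bialgebra_morphism_def by auto
  have "pcompose (\<phi> (gen \<pi>)) [:1, 1:] = poly (tensor_map \<phi> (Delta_ncp (gen \<pi>))) 1"
    unfolding D[symmetric] Delta_poly_at_1 ..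
  also have "Delta_ncp (gen \<pi>) = Delta_gen \<pi>"
    unfolding Delta_ncp_def by (rule alg_extend_gen) simp
  finally show ?thesis
    unfolding Delta_gen_def tensor_map_sum_at_1[OF hom] tensor_map_tensor_at_1[OF hom] .
qed

lemma phi_gen_at_0:
  assumes "double_bialgebra_morphism \<phi>"
  shows "poly (\<phi> (gen \<pi>)) 0 = 0"
  using assms unfolding double_bialgebra_morphism_def counit_Delta_def by (simp add: alg_extend_gen)

lemma phi_gen_at_1:
  assumes "double_bialgebra_morphism \<phi>"
  shows "poly (\<phi> (gen \<pi>)) 1 = (if card (blocks \<pi>) = 1 then 1 else 0)"
  using assms unfolding double_bialgebra_morphism_def counit_delta_def by (simp add: alg_extend_gen)

section \<open>The weight of an ideal\<close>

lemma runs_empty: "runs {} = {}"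
  unfolding runs_def by auto

lemma runs_interval:
  assumes "s \<le> t"
  shows "runs {s..t} = {{s..t}}"
proof
  show "runs {s..t} \<subseteq> {{s..t}}" unfolding runs_def by blast
  show "{{s..t}} \<subseteq> runs {s..t}" unfolding runs_def using assms by blast
qed

lemma runs_two_intervals:
  fixes s t u v :: nat
  assumes "s \<le> t" "t + 1 < u" "u \<le> v"
  shows "runs ({s..t} \<union> {u..v}) = {{s..t}, {u..v}}"
proof -
  let ?S = "{s..t} \<union> {u..v}"
  have split: "{a..b} \<subseteq> {s..t} \<or> {a..b} \<subseteq> {u..v}" if sub: "{a..b} \<subseteq> ?S" for a b
  proof (rule ccontr)
    assume n: "\<not> ?thesis"
    have "t + 1 \<notin> {a..b}" using sub assms by (auto dest!: subsetD[of _ _ "t + 1"])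
    then consider "b \<le> t" | "t + 1 < a" | "b < a" by fastforce
    then show False
    proof cases
      case 1
      then have "{a..b} \<subseteq> {s..t}" using sub assms by fastforce
      then show False using n by blast
    next
      case 2
      then have "{a..b} \<subseteq> {u..v}" using sub assms by fastforce
      then show False using n by blast
    next
      case 3
      then show False using n by simp
    qed
  qed
  have mx: "{s..t} \<in> runs ?S" "{u..v} \<in> runs ?S"
  proof -
    have "{s..t} = {a..b}" if ab: "{s..t} \<subseteq> {a..b}" "{a..b} \<subseteq> ?S" for a b
    proof -
      have "\<not> {a..b} \<subseteq> {u..v}"
      proof
        assume "{a..b} \<subseteq> {u..v}"
        then have "s \<in> {u..v}" using ab(1) assms(1) by auto
        then show False using assms by auto
      qed
      then show ?thesis using split[OF ab(2)] ab(1) by blast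
    qed
    then show "{s..t} \<in> runs ?S" using assms(1) unfolding runs_def by blast
    have "{u..v} = {a..b}" if ab: "{u..v} \<subseteq> {a..b}" "{a..b} \<subseteq> ?S" for a b
    proof -
      have "\<not> {a..b} \<subseteq> {s..t}"
      proof
        assume "{a..b} \<subseteq> {s..t}"
        then have "u \<in> {s..t}" using ab(1) assms(3) by auto
        then show False using assms by auto
      qed
      then show ?thesis using split[OF ab(2)] ab(1) by blast
    qed
    then show "{u..v} \<in> runs ?S" using assms(3) unfolding runs_def by blast
  qed
  moreover have "runs ?S \<subseteq> {{s..t}, {u..v}}"
  proof
    fix I assume I: "I \<in> runs ?S"
    then obtain a b where ab: "I = {a..b}" "I \<subseteq> ?S"
      and m: "\<And>a b. I \<subseteq> {a..b} \<Longrightarrow> {a..b} \<subseteq> ?S \<Longrightarrow> I = {a..b}" unfolding runs_def by blast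
    then show "I \<in> {{s..t}, {u..v}}" using split[of a b] m[of s t] m[of u v] by blast
  qed
  ultimately show ?thesis by blast
qed

context
  fixes P :: "nat set set"
  assumes P: "is_ncp P"
begin

lemma ncp_family: "nc_family P"
  by (rule nc_family_of_is_ncp[OF P])

text \<open>A block with an element in the range of \<open>b\<close> is nested in \<open>b\<close>, and the ideal is upward closed.\<close>
lemma ideal_covers_range:
  assumes J: "J \<in> ideals P" and b: "b \<in> J"
  shows "{Min b..Max b} \<subseteq> \<Union>J"
proof
  fix x assume x: "x \<in> {Min b..Max b}"
  note Y = ncp_family
  have bP: "b \<in> P" using J b unfolding ideals_def by auto
  obtain n where n: "\<Union>P = {1..n}" using P unfolding is_ncp_def partition_on_def by auto
  have "Min b \<in> {1..n}" "Max b \<in> {1..n}"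
    using block_Min_in[OF Y bP] block_Max_in[OF Y bP] bP n by blast+
  then have "x \<in> \<Union>P" unfolding n using x by auto
  then obtain c where c: "c \<in> P" "x \<in> c" by auto
  then have "nest_le b c" using nest_le_of_mem_range[OF Y bP c] x by auto
  then show "x \<in> \<Union>J" using J b c unfolding ideals_def by blast
qed

lemma singleton_ideal_iff: "{l} \<in> ideals P \<longleftrightarrow> l \<in> leaves P"
  unfolding ideals_def leaves_def by auto

lemma leaf_is_interval:
  assumes "l \<in> leaves P"
  shows "l = {Min l..Max l}"
proof
  have l: "l \<in> P" using assms unfolding leaves_def by auto
  show "l \<subseteq> {Min l..Max l}" using block_finite[OF ncp_family l] by auto
  show "{Min l..Max l} \<subseteq> l"
    using ideal_covers_range[of "{l}" l] singleton_ideal_iff assms by auto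
qed

lemma blocks_in_leaf:
  assumes "l \<in> leaves P"
  shows "{b \<in> P. b \<subseteq> l} = {l}"
  using assms leaf_is_interval[OF assms] unfolding leaves_def nest_le_def by auto

lemma leaf_pair_ideal:
  assumes "b \<in> leaves P" "c \<in> leaves P"
  shows "{b, c} \<in> ideals P"
  using assms unfolding ideals_def leaves_def by auto

lemma touching_iff:
  assumes "b \<in> P" "c \<in> P" "Max b < Min c"
  shows "touching P (b, c) \<longleftrightarrow> Max b + 1 = Min c"
proof -
  obtain n where n: "\<Union>P = {1..n}" using P unfolding is_ncp_def partition_on_def by auto
  have "Min c \<in> {1..n}" using block_Min_in[OF ncp_family assms(2)] assms(2) n by blast
  then have "gap b c \<subseteq> {1..n}" unfolding gap_def by auto
  then have "touching P (b, c) \<longleftrightarrow> gap b c = {}" unfolding touching_def n by auto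
  also have "\<dots> \<longleftrightarrow> Max b + 1 \<notin> gap b c" unfolding gap_def by auto
  also have "\<dots> \<longleftrightarrow> Max b + 1 = Min c" using assms(3) unfolding gap_def by auto
  finally show ?thesis .
qed

text \<open>Standardizing is an increasing relabelling.\<close>
lemma standardize_ncp:
  assumes "Y \<subseteq> P"
  shows "card (standardize Y) = card Y" "num_lin_ext (standardize Y) = num_lin_ext Y"
    "(pair_sum (standardize Y) :: 'k::field_char_0) = pair_sum Y"
proof -
  define S g where "S = \<Union>Y" and "g = (\<lambda>x. card {y \<in> S. y \<le> x})"
  have Y: "nc_family Y" using nc_family_subset[OF ncp_family assms] .
  have fin: "finite S" unfolding S_def using block_finite[OF Y] family_finite[OF Y] by auto
  have sm: "strict_mono_on S g"
  proof (rule strict_mono_onI)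
    fix x y assume xy: "x \<in> S" "y \<in> S" "x < y"
    then have "y \<in> {z \<in> S. z \<le> y} - {z \<in> S. z \<le> x}" "{z \<in> S. z \<le> x} \<subseteq> {z \<in> S. z \<le> y}" by auto
    then have "{z \<in> S. z \<le> x} \<subset> {z \<in> S. z \<le> y}" by blast
    then show "g x < g y" unfolding g_def using fin by (intro psubset_card_mono) auto
  qed
  have std: "standardize Y = (`) g ` Y" unfolding standardize_def g_def S_def by blast
  have "inj_on ((`) g) Y"
    by (rule inj_on_subset[OF inj_on_image_Pow[OF relabel_inj[OF sm]]]) (auto simp: S_def)
  then show "card (standardize Y) = card Y" unfolding std by (rule card_image)
  show "num_lin_ext (standardize Y) = num_lin_ext Y"
    unfolding std by (rule num_lin_ext_relabel[OF sm]) (use block_finite[OF Y] block_nonempty[OF Y] family_finite[OF Y] in \<open>auto simp: S_def\<close>)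
  show "(pair_sum (standardize Y) :: 'k) = pair_sum Y"
    unfolding std by (rule pair_sum_relabel[OF sm Y]) (simp add: S_def)
qed

lemma restrict_ncp_eq_gen:
  assumes "Y \<subseteq> P" "Y \<noteq> {}"
  shows "\<exists>\<rho>. blocks \<rho> = standardize Y \<and> (restrict_ncp Y :: 'k::field_char_0 ncp_alg) = gen \<rho>"
  using assms is_ncp_standardize[OF P assms] Abs_ncp_inverse[of "standardize Y"]
  unfolding restrict_ncp_def by auto

context
  fixes \<phi> :: "'k::field_char_0 ncp_alg \<Rightarrow> 'k poly"
  assumes dbl: "double_bialgebra_morphism \<phi>"
begin

lemma phi_restrict_at_1:
  assumes "Y \<subseteq> P" "Y \<noteq> {}"
  shows "poly (\<phi> (restrict_ncp Y)) 1 = (if card Y = 1 then 1 else 0)"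
proof -
  obtain \<rho> where r: "blocks \<rho> = standardize Y" "(restrict_ncp Y :: 'k ncp_alg) = gen \<rho>"
    using restrict_ncp_eq_gen[OF assms] by blast
  then show ?thesis using phi_gen_at_1[OF dbl] standardize_ncp(1)[OF assms(1)] by simp
qed

text \<open>Evaluation at \<open>1\<close> is multiplicative, so by \<open>phi_restrict_at_1\<close> the weight of an ideal is \<open>1\<close> if
each of its runs is one block and \<open>0\<close> otherwise. The following lemmas make this explicit for
ideals with at most two blocks.\<close>
lemma weight_eq_prod:
  "poly (\<phi> (restrict_dot_ideal P J)) 1 = (\<Prod>I\<in>runs (\<Union>J). poly (\<phi> (restrict_ncp {b \<in> P. b \<subseteq> I})) 1)"
  unfolding restrict_dot_ideal_def hom_prod[OF algebra_morphism_of_double[OF dbl]] poly_prod ..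

lemma weight_empty: "poly (\<phi> (restrict_dot_ideal P {})) 1 = 1"
  unfolding weight_eq_prod by (simp add: runs_empty)

lemma weight_leaf:
  assumes l: "l \<in> leaves P"
  shows "poly (\<phi> (restrict_dot_ideal P {l})) 1 = 1"
proof -
  have lP: "l \<in> P" using l unfolding leaves_def by auto
  have "runs l = {l}"
    using runs_interval[OF block_Min_le_Max[OF ncp_family lP]] leaf_is_interval[OF l] by simp
  then show ?thesis
    unfolding weight_eq_prod using lP by (simp add: blocks_in_leaf[OF l] phi_restrict_at_1)
qed

lemma weight_separated_leaves:
  assumes p: "(b, c) \<in> leaf_pairs P" "\<not> touching P (b, c)"
  shows "poly (\<phi> (restrict_dot_ideal P {b, c})) 1 = 1"
proof -
  have lv: "b \<in> leaves P" "c \<in> leaves P" and lt: "Max b < Min c" using p unfolding leaf_pairs_def by auto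
  have b: "b \<in> P" and c: "c \<in> P" using lv unfolding leaves_def by auto
  note o = block_Min_le_Max[OF ncp_family b] block_Min_le_Max[OF ncp_family c]
  have "Max b + 1 < Min c" using touching_iff[OF b c lt] p lt by auto
  then have "runs ({Min b..Max b} \<union> {Min c..Max c}) = {{Min b..Max b}, {Min c..Max c}}"
    using o by (intro runs_two_intervals) auto
  then have "runs (\<Union>{b, c}) = {b, c}"
    using leaf_is_interval[OF lv(1)] leaf_is_interval[OF lv(2)] by simp
  moreover have "b \<noteq> c" using lt o by auto
  ultimately show ?thesis
    unfolding weight_eq_prod using b c
    by (simp add: blocks_in_leaf[OF lv(1)] blocks_in_leaf[OF lv(2)] phi_restrict_at_1)
qed

lemma weight_interval:
  assumes J: "J \<subseteq> P" "b \<in> J" "c \<in> J" "b \<noteq> c" and U: "\<Union>J = {s..t}"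
  shows "poly (\<phi> (restrict_dot_ideal P J)) 1 = 0"
proof -
  let ?Z = "{x \<in> P. x \<subseteq> {s..t}}"
  have "b \<noteq> {}" using J block_nonempty[OF ncp_family] by blast
  then have "s \<le> t" using J(2) U by (metis Sup_upper atLeastatMost_empty_iff subset_empty)
  moreover have bc: "b \<in> ?Z" "c \<in> ?Z" using J U by blast+
  moreover have "card ?Z \<noteq> 1" using bc J(4) by (metis card_1_singletonE singletonD)
  ultimately show ?thesis
    unfolding weight_eq_prod U runs_interval[OF \<open>s \<le> t\<close>]
    using phi_restrict_at_1[of ?Z] by auto
qed

text \<open>If \<open>c\<close> is nested in \<open>b\<close>, or both are leaves that touch, the two blocks fill a single interval.
Two blocks side by side that form an ideal are leaves.\<close>
lemma weight_pair_zero: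
  assumes J: "{b, c} \<in> ideals P" "b \<noteq> c"
    and p: "nest_le b c \<or> Max b < Min c \<and> \<not> ((b, c) \<in> leaf_pairs P \<and> \<not> touching P (b, c))"
  shows "poly (\<phi> (restrict_dot_ideal P {b, c})) 1 = 0"
proof -
  have b: "b \<in> P" and c: "c \<in> P" and up: "\<And>x y. x \<in> {b, c} \<Longrightarrow> y \<in> P \<Longrightarrow> nest_le x y \<Longrightarrow> y \<in> {b, c}"
    using J unfolding ideals_def by auto
  note o = block_Min_le_Max[OF ncp_family b] block_Min_le_Max[OF ncp_family c]
  show ?thesis
  proof (cases "nest_le b c")
    case True
    have "b \<subseteq> {Min b..Max b}" using block_finite[OF ncp_family b] by auto
    then have "\<Union>{b, c} = {Min b..Max b}"
      using ideal_covers_range[OF J(1), of b] True unfolding nest_le_def by auto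
    then show ?thesis by (rule weight_interval[rotated 4]) (use b c J in auto)
  next
    case False
    then have lt: "Max b < Min c" using p by auto
    have "b \<in> leaves P" using up[of b] b False unfolding leaves_def by auto
    moreover have "\<not> nest_le c b" using lt o block_nest_le_iff[OF ncp_family c b] by auto
    then have "c \<in> leaves P" using up[of c] c unfolding leaves_def by auto
    ultimately have lv: "b = {Min b..Max b}" "c = {Min c..Max c}" and lp: "(b, c) \<in> leaf_pairs P"
      using leaf_is_interval lt unfolding leaf_pairs_def by auto
    have m: "Max b + 1 = Min c" using touching_iff[OF b c lt] lp p False by auto
    have "\<Union>{b, c} = {Min b..Max b} \<union> {Min c..Max c}" using lv by auto
    also have "\<dots> = {Min b..Max c}" using m o by auto
    finally show ?thesis by (rule weight_interval[rotated 4]) (use b c J in auto)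
  qed
qed

text \<open>In the application \<open>f J\<close> is one of the two highest coefficients of a polynomial whose degree is at
most the number of blocks outside \<open>J\<close>; this is why large ideals do not count.\<close>
lemma sum_over_ideals:
  fixes f :: "nat set set \<Rightarrow> 'k"
  assumes f: "\<And>J. J \<in> ideals P \<Longrightarrow> card J \<ge> 3 \<Longrightarrow> f J = 0"
  shows "(\<Sum>J\<in>ideals P. poly (\<phi> (restrict_dot_ideal P J)) 1 * f J) =
    f {} + (\<Sum>l\<in>leaves P. f {l}) + (\<Sum>p\<in>{p \<in> leaf_pairs P. \<not> touching P p}. f {fst p, snd p})"
proof -
  let ?w = "\<lambda>J. poly (\<phi> (restrict_dot_ideal P J)) 1" and ?N = "{p \<in> leaf_pairs P. \<not> touching P p}"
  let ?A = "(\<lambda>l. {l}) ` leaves P" and ?B = "(\<lambda>p. {fst p, snd p}) ` ?N"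
  note Y = ncp_family
  have finI: "finite (ideals P)"
    by (rule finite_subset[of _ "Pow P"]) (use family_finite[OF Y] in \<open>auto simp: ideals_def\<close>)
  have irr: "\<not> Max b < Min b" if "b \<in> leaves P" for b
    using block_Min_le_Max[OF Y, of b] that unfolding leaves_def by auto
  have N: "fst p \<in> leaves P" "snd p \<in> leaves P" "Max (fst p) < Min (snd p)" "fst p \<noteq> snd p" if "p \<in> ?N" for p
    using that irr unfolding leaf_pairs_def by auto
  have sub: "{{}} \<union> (?A \<union> ?B) \<subseteq> ideals P"
  proof -
    have "{} \<in> ideals P" unfolding ideals_def by auto
    moreover have "?A \<subseteq> ideals P" using singleton_ideal_iff by auto
    moreover have "?B \<subseteq> ideals P" using leaf_pair_ideal N by auto
    ultimately show ?thesis by auto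
  qed
  have zero: "?w J * f J = 0" if J: "J \<in> ideals P - ({{}} \<union> (?A \<union> ?B))" for J
  proof (cases "card J \<ge> 3")
    case True
    then show ?thesis using f J by simp
  next
    case False
    have JP: "J \<subseteq> P" "finite J" using J family_finite[OF Y] finite_subset unfolding ideals_def by auto
    have "card J \<noteq> 0" using J JP by auto
    moreover have "card J \<noteq> 1"
    proof
      assume "card J = 1"
      then obtain l where "J = {l}" by (rule card_1_singletonE)
      then show False using J singleton_ideal_iff by auto
    qed
    ultimately have "card J = 2" using False by linarith
    then obtain b c where bc: "J = {b, c}" "b \<noteq> c" by (meson card_2_iff)
    have nN: "(b, c) \<notin> ?N" "(c, b) \<notin> ?N" using J unfolding bc by (auto simp: image_iff insert_commute)
    have id: "{b, c} \<in> ideals P" "{c, b} \<in> ideals P" using J bc by (auto simp: insert_commute)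
    have "nest_le b c \<or> nest_le c b \<or> Max b < Min c \<or> Max c < Min b"
      by (rule block_trichotomy[OF Y]) (use JP bc in auto)
    then have "?w {b, c} = 0 \<or> ?w {c, b} = 0"
      using weight_pair_zero[OF id(1) bc(2)] weight_pair_zero[OF id(2) bc(2)[symmetric]] nN by blast
    then have "?w {b, c} = 0" unfolding insert_commute[of c b] by simp
    then show ?thesis using bc by simp
  qed
  have w: "?w J = 1" if "J \<in> {{}} \<union> (?A \<union> ?B)" for J
    using that
  proof (elim UnE imageE singletonE)
    fix p assume "J = {fst p, snd p}" "p \<in> ?N"
    then show ?thesis using weight_separated_leaves[of "fst p" "snd p"] by simp
  qed (simp_all add: weight_empty weight_leaf)
  have fin: "finite (leaves P)" "finite ?N"
    using finite_leaves[OF Y] finite_pairs(3)[OF Y] by auto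
  have "(\<Sum>J\<in>ideals P. ?w J * f J) = (\<Sum>J\<in>{{}} \<union> (?A \<union> ?B). ?w J * f J)"
    by (rule sum.mono_neutral_right[OF finI sub]) (use zero in blast)
  also have "\<dots> = (\<Sum>J\<in>{{}} \<union> (?A \<union> ?B). f J)"
    by (rule sum.cong[OF refl]) (simp only: w mult_1)
  also have "\<dots> = f {} + ((\<Sum>J\<in>?A. f J) + (\<Sum>J\<in>?B. f J))"
  proof -
    have "{l} \<noteq> {fst p, snd p}" if "p \<in> ?N" for l p
      using N(4)[OF that] by (metis insertI1 insertI2 singletonD)
    then have "?A \<inter> ?B = {}" by blast
    then have "(\<Sum>J\<in>?A \<union> ?B. f J) = (\<Sum>J\<in>?A. f J) + (\<Sum>J\<in>?B. f J)"
      using fin by (intro sum.union_disjoint) auto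
    moreover have "(\<Sum>J\<in>{{}} \<union> (?A \<union> ?B). f J) = f {} + (\<Sum>J\<in>?A \<union> ?B. f J)"
      using fin by (subst sum.union_disjoint) auto
    ultimately show ?thesis by simp
  qed
  also have "(\<Sum>J\<in>?A. f J) = (\<Sum>l\<in>leaves P. f {l})"
    by (subst sum.reindex) auto
  also have "(\<Sum>J\<in>?B. f J) = (\<Sum>p\<in>?N. f {fst p, snd p})"
  proof (subst sum.reindex)
    show "inj_on (\<lambda>p. {fst p, snd p}) ?N"
    proof (rule inj_onI)
      fix p q assume pq: "p \<in> ?N" "q \<in> ?N" "{fst p, snd p} = {fst q, snd q}"
      have "\<not> (fst p = snd q \<and> snd p = fst q)"
      proof
        assume "fst p = snd q \<and> snd p = fst q"
        then show False using N(3)[OF pq(1)] N(3)[OF pq(2)] irr[OF N(1)[OF pq(1)]] irr[OF N(2)[OF pq(1)]] by auto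
      qed
      then show "p = q" using pq(3) by (auto simp: doubleton_eq_iff prod_eq_iff)
    qed
  qed simp
  finally show ?thesis by (simp add: add.assoc)
qed

end
end

section \<open>The two highest coefficients\<close>

lemma standardize_blocks: "standardize (blocks \<pi>) = blocks \<pi>"
proof -
  obtain n where n: "\<Union>(blocks \<pi>) = {1..n}"
    using blocks[of \<pi>] unfolding is_ncp_def partition_on_def by auto
  have "card {y \<in> \<Union>(blocks \<pi>). y \<le> x} = x" if "x \<in> \<Union>(blocks \<pi>)" for x
  proof -
    have "{y \<in> \<Union>(blocks \<pi>). y \<le> x} = {1..x}" using that unfolding n by auto
    then show ?thesis by simp
  qed
  then have "(\<lambda>x. card {y \<in> \<Union>(blocks \<pi>). y \<le> x}) ` b = b" if "b \<in> blocks \<pi>" for b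
    using that by (force simp: image_iff)
  then show ?thesis unfolding standardize_def by simp
qed

lemma blocks_nonempty: "blocks \<pi> \<noteq> {}"
  using blocks[of \<pi>] unfolding is_ncp_def partition_on_def by fastforce

lemma restrict_blocks: "restrict_ncp (blocks \<pi>) = gen \<pi>"
  unfolding restrict_ncp_def by (simp add: standardize_blocks blocks_nonempty blocks_inverse)

text \<open>By induction on the number of blocks: the shift formula determines the two highest coefficients from
those of smaller partitions, through recursions that \<open>num_lin_ext_rec\<close> and \<open>pair_sum_rec\<close> solve.\<close>
lemma top_coeffs_phi_gen:
  fixes \<phi> :: "'k::field_char_0 ncp_alg \<Rightarrow> 'k poly"
  assumes dbl: "double_bialgebra_morphism \<phi>"
  shows "degree (\<phi> (gen \<pi>)) \<le> card (blocks \<pi>) \<and>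
    coeff (\<phi> (gen \<pi>)) (card (blocks \<pi>)) = of_nat (num_lin_ext (blocks \<pi>)) / fact (card (blocks \<pi>)) \<and>
    coeff (\<phi> (gen \<pi>)) (card (blocks \<pi>) - 1) = - pair_sum (blocks \<pi>) / fact (card (blocks \<pi>) - 1)"
proof (induction "card (blocks \<pi>)" arbitrary: \<pi> rule: less_induct)
  case less
  define P where "P = blocks \<pi>"
  define n where "n = card P"
  define p where "p = \<phi> (gen \<pi>)"
  define F where "F J = \<phi> (restrict_ncp (P - J))" for J
  let ?w = "\<lambda>J. poly (\<phi> (restrict_dot_ideal P J)) 1"
  let ?N = "{p \<in> leaf_pairs P. \<not> touching P p}"
  have P: "is_ncp P" using blocks[of \<pi>] unfolding P_def by simp
  have Y: "nc_family P" using nc_family_of_is_ncp[OF P] .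
  have fin: "finite P" using family_finite[OF Y] .
  have ne: "P \<noteq> {}" unfolding P_def by (rule blocks_nonempty)
  have n1: "n \<ge> 1" using fin ne unfolding n_def by (simp add: Suc_le_eq card_gt_0_iff)
  \<comment> \<open>The induction hypothesis, stated without standardizing and including the empty family.\<close>
  have IH: "degree (\<phi> (restrict_ncp Z)) \<le> card Z"
    "coeff (\<phi> (restrict_ncp Z)) (card Z) = of_nat (num_lin_ext Z) / fact (card Z)"
    "Z \<noteq> {} \<Longrightarrow> coeff (\<phi> (restrict_ncp Z)) (card Z - 1) = - pair_sum Z / fact (card Z - 1)"
    if Z: "Z \<subset> P" for Z
  proof -
    have "degree (\<phi> (restrict_ncp Z)) \<le> card Z \<and>
      coeff (\<phi> (restrict_ncp Z)) (card Z) = of_nat (num_lin_ext Z) / fact (card Z) \<and>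
      (Z \<noteq> {} \<longrightarrow> coeff (\<phi> (restrict_ncp Z)) (card Z - 1) = - pair_sum Z / fact (card Z - 1))"
    proof (cases "Z = {}")
      case True
      then show ?thesis using hom_one[OF algebra_morphism_of_double[OF dbl]] by (simp add: restrict_ncp_def num_lin_ext_empty)
    next
      case False
      have ZP: "Z \<subseteq> P" using Z by auto
      obtain \<rho> where r: "blocks \<rho> = standardize Z" "(restrict_ncp Z :: 'k ncp_alg) = gen \<rho>"
        using restrict_ncp_eq_gen[OF P ZP False] by blast
      note st = standardize_ncp[OF P ZP]
      have "card (blocks \<rho>) < card (blocks \<pi>)"
        unfolding r st(1) P_def[symmetric] by (rule psubset_card_mono[OF fin Z])
      from less[OF this] show ?thesis unfolding r st by simp
    qed
    then show "degree (\<phi> (restrict_ncp Z)) \<le> card Z"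
      "coeff (\<phi> (restrict_ncp Z)) (card Z) = of_nat (num_lin_ext Z) / fact (card Z)"
      "Z \<noteq> {} \<Longrightarrow> coeff (\<phi> (restrict_ncp Z)) (card Z - 1) = - pair_sum Z / fact (card Z - 1)" by auto
  qed
  have idP: "J \<subseteq> P" "finite J" if "J \<in> ideals P" for J
    using that fin finite_subset unfolding ideals_def by auto
  have finI: "finite (ideals P)"
    by (rule finite_subset[of _ "Pow P"]) (use fin idP in auto)
  have degF: "degree (F J) \<le> n - card J" if J: "J \<in> ideals P" "J \<noteq> {}" for J
  proof -
    have "P - J \<subset> P" "card (P - J) = n - card J"
      using idP[OF J(1)] J(2) unfolding n_def by (auto simp: card_Diff_subset)
    then show ?thesis using IH(1)[of "P - J"] unfolding F_def by simp
  qed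
  have F0: "F {} = p" unfolding F_def p_def P_def by (simp add: restrict_blocks)
  have shift: "pcompose p [:1, 1:] = (\<Sum>J\<in>ideals P. smult (?w J) (F J))"
    unfolding p_def F_def P_def by (rule shift_phi_gen[OF dbl])
  have deg: "degree p \<le> n"
  proof (rule degree_le_of_shift_diff)
    have e: "{} \<in> ideals P" unfolding ideals_def by auto
    have "pcompose p [:1, 1:] - p = (\<Sum>J\<in>ideals P - {{}}. smult (?w J) (F J))"
      unfolding shift sum.remove[OF finI e] using F0 weight_empty[OF P dbl] by simp
    also have "degree \<dots> < n"
    proof (rule degree_sum_less)
      fix J assume J: "J \<in> ideals P - {{}}"
      have "degree (smult (?w J) (F J)) \<le> n - card J" using degree_smult_le degF J order_trans by blast
      also have "\<dots> < n" using J idP[of J] n1 by (simp add: card_gt_0_iff)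
      finally show "degree (smult (?w J) (F J)) < n" .
    qed (use n1 in simp)
    finally show "degree (pcompose p [:1, 1:] - p) < n" .
  qed
  have leaf: "P - {l} \<subset> P" "card (P - {l}) = n - 1" if "l \<in> leaves P" for l
    using that fin unfolding leaves_def n_def by auto
  have pairs: "P - {fst q, snd q} \<subset> P" "card (P - {fst q, snd q}) = n - 2" if q: "q \<in> ?N" for q
  proof -
    have bc: "fst q \<in> P" "snd q \<in> P" "Max (fst q) < Min (snd q)"
      using q unfolding leaf_pairs_def leaves_def by auto
    then have d: "fst q \<noteq> snd q" using block_Min_le_Max[OF Y bc(1)] by auto
    show "P - {fst q, snd q} \<subset> P" using bc by auto
    show "card (P - {fst q, snd q}) = n - 2" using bc d fin unfolding n_def by (simp add: card_Diff_subset)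
  qed
  have coeffs: "coeff (pcompose p [:1, 1:]) k = coeff p k +
      (\<Sum>l\<in>leaves P. coeff (F {l}) k) + (\<Sum>q\<in>?N. coeff (F {fst q, snd q}) k)"
    if k: "k \<ge> n - 2" "n \<ge> 3 \<longrightarrow> k \<noteq> 0" for k
  proof -
    have "coeff (pcompose p [:1, 1:]) k = (\<Sum>J\<in>ideals P. ?w J * coeff (F J) k)"
      unfolding shift by (simp add: coeff_sum)
    also have "\<dots> = coeff (F {}) k + (\<Sum>l\<in>leaves P. coeff (F {l}) k) + (\<Sum>q\<in>?N. coeff (F {fst q, snd q}) k)"
    proof (rule sum_over_ideals[OF P dbl])
      fix J assume J: "J \<in> ideals P" "card J \<ge> 3"
      then have "n \<ge> 3" using idP card_mono[OF fin] unfolding n_def by (meson order_trans)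
      moreover have "J \<noteq> {}" using J(2) by auto
      ultimately show "coeff (F J) k = 0" using degF[OF J(1)] J(2) k by (intro coeff_eq_0) linarith
    qed
    finally show ?thesis unfolding F0 .
  qed
  have an: "of_nat n * coeff p n = of_nat (num_lin_ext P) / fact (n - 1)"
  proof -
    obtain m where m: "n = Suc m" using n1 by (cases n) auto
    have "coeff (pcompose p [:1, 1:]) m = coeff p m + of_nat n * coeff p n + (\<Sum>i<m. coeff p i * of_nat (i choose m))"
      unfolding coeff_shift[OF deg] by (simp add: m lessThan_Suc_atMost[symmetric] algebra_simps)
    also have "(\<Sum>i<m. coeff p i * of_nat (i choose m)) = 0"
      by (rule sum.neutral) (simp add: binomial_eq_0)
    finally have "of_nat n * coeff p n = (\<Sum>l\<in>leaves P. coeff (F {l}) m) + (\<Sum>q\<in>?N. coeff (F {fst q, snd q}) m)"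
      using coeffs[of m] m by simp
    also have "(\<Sum>q\<in>?N. coeff (F {fst q, snd q}) m) = 0"
    proof (rule sum.neutral, intro ballI coeff_eq_0)
      fix q assume q: "q \<in> ?N"
      have "card (P - {fst q, snd q}) < m"
      proof -
        have "{fst q, snd q} \<subseteq> P" "fst q \<noteq> snd q"
          using q block_Min_le_Max[OF Y] unfolding leaf_pairs_def leaves_def by fastforce+
        then have "card {fst q, snd q} \<le> n" using card_mono[OF fin] unfolding n_def by blast
        then show ?thesis using pairs(2)[OF q] m \<open>fst q \<noteq> snd q\<close> by simp
      qed
      then show "degree (F {fst q, snd q}) < m" using IH(1)[OF pairs(1)[OF q]] unfolding F_def by simp
    qed
    also have "(\<Sum>l\<in>leaves P. coeff (F {l}) m) = (\<Sum>l\<in>leaves P. of_nat (num_lin_ext (P - {l})) / fact m)"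
      by (rule sum.cong[OF refl]) (use IH(2)[OF leaf(1)] leaf(2) m in \<open>simp add: F_def\<close>)
    also have "\<dots> = of_nat (num_lin_ext P) / fact m"
      unfolding num_lin_ext_rec[OF fin ne] by (simp add: sum_divide_distrib)
    finally show ?thesis using m by simp
  qed
  have lead: "coeff p n = of_nat (num_lin_ext P) / fact n"
  proof -
    have "(fact n :: 'k) = of_nat n * fact (n - 1)" using n1 by (simp add: fact_reduce)
    then show ?thesis using an n1 by (simp add: field_simps)
  qed
  have sub: "coeff p (n - 1) = - pair_sum P / fact (n - 1)"
  proof (cases "n \<ge> 2")
    case False
    then have n: "n = 1" using n1 by simp
    \<comment> \<open>The recursion says nothing here; the constant coefficient vanishes by the counit of \<open>\<Delta>\<close>.\<close>
    then obtain b where b: "P = {b}" unfolding n_def by (rule card_1_singletonE)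
    have "\<not> Max b < Min b" using block_Min_le_Max[OF Y, of b] b by simp
    then have "sibling_pairs P = {}" unfolding sibling_pairs_def b by blast
    moreover have "nested_pairs P = {}" unfolding nested_pairs_def b by blast
    ultimately have "pair_sum P = (0 :: 'k)" unfolding pair_sum_def by simp
    moreover have "coeff p 0 = 0" using phi_gen_at_0[OF dbl, of \<pi>] unfolding p_def by (simp add: poly_0_coeff_0)
    ultimately show ?thesis using n by simp
  next
    case True
    then obtain m where m: "n = Suc (Suc m)" by (metis add_2_eq_Suc le_Suc_ex)
    have "coeff (pcompose p [:1, 1:]) m = coeff p m + of_nat (Suc m) * coeff p (Suc m) +
        of_nat (n choose m) * coeff p n + (\<Sum>i<m. coeff p i * of_nat (i choose m))"
      unfolding coeff_shift[OF deg] by (simp add: m lessThan_Suc_atMost[symmetric] algebra_simps del: binomial_Suc_Suc)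
    also have "(\<Sum>i<m. coeff p i * of_nat (i choose m)) = 0"
      by (rule sum.neutral) (simp add: binomial_eq_0)
    finally have "of_nat (Suc m) * coeff p (Suc m) + of_nat (n choose m) * coeff p n =
        (\<Sum>l\<in>leaves P. coeff (F {l}) m) + (\<Sum>q\<in>?N. coeff (F {fst q, snd q}) m)"
      using coeffs[of m] m by simp
    also have "(\<Sum>l\<in>leaves P. coeff (F {l}) m) = (\<Sum>l\<in>leaves P. - pair_sum (P - {l}) / fact m)"
    proof (rule sum.cong[OF refl])
      fix l assume l: "l \<in> leaves P"
      have "card (P - {l}) \<noteq> 0" using leaf(2)[OF l] m by simp
      then have "P - {l} \<noteq> {}" by (metis card.empty)
      then show "coeff (F {l}) m = - pair_sum (P - {l}) / fact m"
        using IH(3)[OF leaf(1)[OF l]] leaf(2)[OF l] m unfolding F_def by simp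
    qed
    also have "(\<Sum>q\<in>?N. coeff (F {fst q, snd q}) m) = (\<Sum>q\<in>?N. of_nat (num_lin_ext (P - {fst q, snd q})) / fact m)"
      by (rule sum.cong[OF refl]) (use IH(2)[OF pairs(1)] pairs(2) m in \<open>simp add: F_def\<close>)
    also have "(\<Sum>l\<in>leaves P. - pair_sum (P - {l}) / fact m) + \<dots> =
       (of_nat (num_lin_ext P) / 2 - pair_sum P) / (fact m :: 'k)"
      using pair_sum_rec[OF Y, where 'k = 'k] True unfolding n_def
      by (simp add: sum_negf diff_divide_distrib flip: sum_divide_distrib)
    also have "of_nat (n choose m) * coeff p n = of_nat (num_lin_ext P) / 2 / (fact m :: 'k)"
    proof -
      have "m \<le> n" "n - m = 2" using m by auto
      then have "of_nat (n choose m) = (fact n / (fact m * 2) :: 'k)" by (simp add: binomial_fact)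
      then show ?thesis unfolding lead by simp
    qed
    finally have "of_nat (Suc m) * coeff p (Suc m) = - pair_sum P / fact m"
      by (simp add: diff_divide_distrib)
    then show ?thesis unfolding m by (simp add: field_simps del: of_nat_Suc)
  qed
  show ?case using deg lead sub unfolding p_def n_def P_def by simp
qed

theorem corollary4p7:
  fixes \<phi> :: "'k::field_char_0 ncp_alg \<Rightarrow> 'k poly" and \<pi> :: ncp and n :: nat
  assumes "double_bialgebra_morphism \<phi>"
    and "card (blocks \<pi>) = n"
  shows "degree (\<phi> (gen \<pi>)) = n \<and>
    coeff (\<phi> (gen \<pi>)) (n - 1) =
      - (1 / fact (card (blocks \<pi>) - 1)) *
        ((\<Sum>p\<in>close_pairs (blocks \<pi>). of_nat (num_lin_ext (merge_pair (blocks \<pi>) p))) +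
         1 / 2 * (\<Sum>p\<in>nested_pairs (blocks \<pi>). of_nat (num_lin_ext (merge_pair (blocks \<pi>) p))))"
proof
  have P: "is_ncp (blocks \<pi>)" using blocks[of \<pi>] by simp
  note tc = top_coeffs_phi_gen[OF assms(1), of \<pi>, unfolded assms(2)]
  have "coeff (\<phi> (gen \<pi>)) n \<noteq> 0"
    using tc num_lin_ext_pos[OF nc_family_of_is_ncp[OF P]] by simp
  then show "degree (\<phi> (gen \<pi>)) = n" using tc le_degree[of "\<phi> (gen \<pi>)" n] by simp
  show "coeff (\<phi> (gen \<pi>)) (n - 1) =
      - (1 / fact (card (blocks \<pi>) - 1)) *
        ((\<Sum>p\<in>close_pairs (blocks \<pi>). of_nat (num_lin_ext (merge_pair (blocks \<pi>) p))) +
         1 / 2 * (\<Sum>p\<in>nested_pairs (blocks \<pi>). of_nat (num_lin_ext (merge_pair (blocks \<pi>) p))))"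
    using tc unfolding close_pairs_eq_sibling_pairs[OF P] pair_sum_def[symmetric] assms(2) by simp
qed

end
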